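(* Let $T$ be a plane rooted tree and $\mu$ a $T$-partition of $N$. Then $S^{T,\mu}$ is isomorphic to a submodule of $\tilde S^{T,\mu}$ (as $\mathfrak S_N$-modules), and $S^{T,\mu}\cong\tilde S^{T,\mu}$ when $T$ is a path (every internal node has exactly one child).
   Context: All vector spaces over $\mathbb C$. $T$ is a plane rooted tree. A $T$-partition of $N$ is a labeling $\mu$ of the nodes by positive integers with $\sum_a\mu(a)=N$ and $\mu(a)\le\mu(b)$ whenever $a$ is the parent of $b$. A $\mu$-tableau assigns to each node $a$ an ordered column $Col(a)$ of $\mu(a)$ distinct positive integers, column entry sets disjoint with union $[N]$; $\mathcal T_{T,\mu}$ is the set of these. $M^{T,\mu}$ is generated by $\mathcal T_{T,\mu}$ modulo the column relations $t+s$ ($s$ obtained from $t$ by switching two entries in the same column); $\bar t$ is the class of $t$; $\mathfrak S_N$ acts by permuting entries. First kind: for a non-root node $a$ with parent $p(a)$, $g_a^t=\bar t-\sum_s\bar s$ over all $s$ obtained from $t$ by exchanging any entry of $Col(a)$ with the top entry of $Col(p(a))$; $S^{T,\mu}=M^{T,\mu}/\langle g_a^t\rangle$. Second kind: for an internal node $a$ with set $D_a$ of proper descendants, $\tilde g_a^t=|D_a|\,\mu(a)\,\bar t-\sum_s\bar s$ over all $s$ obtained from $t$ by exchanging any entry of $Col(a)$ with any entry of $\bigcup_{b\in D_a}Col(b)$; $\tilde S^{T,\mu}=M^{T,\mu}/\langle\tilde g_a^t\rangle$. *)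

theory Defs
  imports
    "HOL-Algebra.Module"
    "HOL-Algebra.AbelCoset"
    "HOL-Algebra.Sym_Groups"
    "HOL-Algebra.Algebraic_Closure_Type"
    "HOL-Combinatorics.Transposition"
    "HOL-Library.Sublist"
begin

section \<open>Complex representations, submodules and quotients\<close>

record ('g, 'v) rep = "(complex, 'v) module" +
  act :: "'g \<Rightarrow> 'v \<Rightarrow> 'v"

abbreviation complex_ring :: "complex ring" where
  "complex_ring \<equiv> ring_of_type_algebra"

definition representation :: "('g, 'm) monoid_scheme \<Rightarrow> ('g, 'v, 'e) rep_scheme \<Rightarrow> bool" where
  "representation G V \<longleftrightarrow>
     group G \<and> module complex_ring V \<and>
     (\<forall>g\<in>carrier G. \<forall>x\<in>carrier V. act V g x \<in> carrier V) \<and>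
     (\<forall>g\<in>carrier G. \<forall>x\<in>carrier V. \<forall>y\<in>carrier V.
        act V g (x \<oplus>\<^bsub>V\<^esub> y) = act V g x \<oplus>\<^bsub>V\<^esub> act V g y) \<and>
     (\<forall>g\<in>carrier G. \<forall>c. \<forall>x\<in>carrier V. act V g (c \<odot>\<^bsub>V\<^esub> x) = c \<odot>\<^bsub>V\<^esub> act V g x) \<and>
     (\<forall>x\<in>carrier V. act V \<one>\<^bsub>G\<^esub> x = x) \<and>
     (\<forall>g\<in>carrier G. \<forall>h\<in>carrier G. \<forall>x\<in>carrier V. act V (g \<otimes>\<^bsub>G\<^esub> h) x = act V g (act V h x))"

definition subrepresentation ::
  "('g, 'm) monoid_scheme \<Rightarrow> 'v set \<Rightarrow> ('g, 'v, 'e) rep_scheme \<Rightarrow> bool" where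
  "subrepresentation G H V \<longleftrightarrow>
     submodule H complex_ring V \<and> (\<forall>g\<in>carrier G. \<forall>x\<in>H. act V g x \<in> H)"

text \<open>Isomorphism includes that both sides really are representations; for the quotients below this
  expresses that the operations on cosets are well defined.\<close>

definition rep_isomorphic ::
  "('g, 'm) monoid_scheme \<Rightarrow> ('g, 'v, 'e) rep_scheme \<Rightarrow> ('g, 'w, 'f) rep_scheme \<Rightarrow> bool" where
  "rep_isomorphic G V W \<longleftrightarrow>
     representation G V \<and> representation G W \<and>
     (\<exists>h. bij_betw h (carrier V) (carrier W) \<and>
        (\<forall>x\<in>carrier V. \<forall>y\<in>carrier V. h (x \<oplus>\<^bsub>V\<^esub> y) = h x \<oplus>\<^bsub>W\<^esub> h y) \<and>
        (\<forall>c. \<forall>x\<in>carrier V. h (c \<odot>\<^bsub>V\<^esub> x) = c \<odot>\<^bsub>W\<^esub> h x) \<and>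
        (\<forall>g\<in>carrier G. \<forall>x\<in>carrier V. h (act V g x) = act W g (h x)))"

definition complex_span :: "('g, 'v, 'e) rep_scheme \<Rightarrow> 'v set \<Rightarrow> 'v set" where
  "complex_span V A = \<Inter> {H. submodule H complex_ring V \<and> A \<subseteq> H}"

text \<open>The quotient \<open>V / W\<close> on additive cosets. The ring-multiplication fields of a module record
  carry no meaning. Scalar multiplication adds \<open>W\<close> because the plain image of a coset under the
  scalar \<open>0\<close> is only \<open>{0}\<close>; a group element acts by image, which is again a coset when \<open>W\<close> is
  stable under the group.\<close>

definition quotient_rep :: "('g, 'v, 'e) rep_scheme \<Rightarrow> 'v set \<Rightarrow> ('g, 'v set) rep" where
  "quotient_rep V W =
     \<lparr> carrier = a_rcosets\<^bsub>V\<^esub> W,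
       monoid.mult = undefined,
       one = undefined,
       ring.zero = W,
       add = set_add V,
       module.smult = (\<lambda>c C. W <+>\<^bsub>V\<^esub> ((\<lambda>x. c \<odot>\<^bsub>V\<^esub> x) ` C)),
       act = (\<lambda>g C. act V g ` C) \<rparr>"


section \<open>Plane rooted trees\<close>

text \<open>A node is addressed by the list of child indices on the way to it from the root \<open>[]\<close>, so its
  parent is given by \<open>butlast\<close> and its proper descendants are its strict extensions.\<close>

datatype plane_tree = Node (subtrees: "plane_tree list")

lemma size_nth_subtree [termination_simp]:
  "i < length ts \<Longrightarrow> size (ts ! i) < Suc (size_list size ts)"
  by (auto simp: less_Suc_eq_le intro: size_list_estimation' nth_mem)

fun nodes :: "plane_tree \<Rightarrow> nat list set" where
  "nodes (Node ts) = insert [] (\<Union>i\<in>{..<length ts}. (#) i ` nodes (ts ! i))"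

definition children :: "plane_tree \<Rightarrow> nat list \<Rightarrow> nat list set" where
  "children T a = {b \<in> nodes T. b \<noteq> [] \<and> butlast b = a}"

definition descendants :: "plane_tree \<Rightarrow> nat list \<Rightarrow> nat list set" where
  "descendants T a = {b \<in> nodes T. strict_prefix a b}"

definition internal_nodes :: "plane_tree \<Rightarrow> nat list set" where
  "internal_nodes T = {a \<in> nodes T. children T a \<noteq> {}}"

definition is_path :: "plane_tree \<Rightarrow> bool" where
  "is_path T \<longleftrightarrow> (\<forall>a\<in>internal_nodes T. card (children T a) = 1)"

definition tree_partition :: "plane_tree \<Rightarrow> nat \<Rightarrow> (nat list \<Rightarrow> nat) \<Rightarrow> bool" where
  "tree_partition T N \<mu> \<longleftrightarrow>
     (\<forall>a\<in>nodes T. 0 < \<mu> a) \<and>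
     (\<Sum>a\<in>nodes T. \<mu> a) = N \<and>
     (\<forall>a\<in>nodes T. \<forall>b\<in>children T a. \<mu> a \<le> \<mu> b)"


section \<open>Tableaux and the module they generate\<close>

text \<open>Columns are listed from top to bottom; outside the tree a tableau is \<open>[]\<close>, so that tableaux
  are determined by their columns.\<close>

type_synonym tableau = "nat list \<Rightarrow> nat list"

definition tableaux :: "plane_tree \<Rightarrow> nat \<Rightarrow> (nat list \<Rightarrow> nat) \<Rightarrow> tableau set" where
  "tableaux T N \<mu> = {t.
     (\<forall>a\<in>nodes T. length (t a) = \<mu> a \<and> distinct (t a)) \<and>
     (\<forall>a\<in>nodes T. \<forall>b\<in>nodes T. a \<noteq> b \<longrightarrow> set (t a) \<inter> set (t b) = {}) \<and>
     (\<Union>a\<in>nodes T. set (t a)) = {1..N} \<and>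
     (\<forall>a. a \<notin> nodes T \<longrightarrow> t a = [])}"

definition permute_entries :: "(nat \<Rightarrow> nat) \<Rightarrow> tableau \<Rightarrow> tableau" where
  "permute_entries p t = (\<lambda>a. map p (t a))"

definition exchange :: "nat \<Rightarrow> nat \<Rightarrow> tableau \<Rightarrow> tableau" where
  "exchange x y = permute_entries (transpose x y)"

text \<open>The complex vector space with basis the tableaux. A permutation \<open>p\<close> sends the basis vector
  of \<open>t\<close> to that of \<open>permute_entries p t\<close>, hence the inverse in the action on functions.\<close>

definition tableau_space :: "plane_tree \<Rightarrow> nat \<Rightarrow> (nat list \<Rightarrow> nat)
    \<Rightarrow> (nat \<Rightarrow> nat, tableau \<Rightarrow> complex) rep" where
  "tableau_space T N \<mu> =
     \<lparr> carrier = {f. \<forall>t. t \<notin> tableaux T N \<mu> \<longrightarrow> f t = 0},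
       monoid.mult = undefined,
       one = undefined,
       ring.zero = (\<lambda>t. 0),
       add = (\<lambda>f g t. f t + g t),
       module.smult = (\<lambda>c f t. c * f t),
       act = (\<lambda>p f t. f (permute_entries (Hilbert_Choice.inv p) t)) \<rparr>"

definition basis_vector :: "tableau \<Rightarrow> tableau \<Rightarrow> complex" where
  "basis_vector t = (\<lambda>s. if s = t then 1 else 0)"

definition column_relations ::
  "plane_tree \<Rightarrow> nat \<Rightarrow> (nat list \<Rightarrow> nat) \<Rightarrow> (tableau \<Rightarrow> complex) set" where
  "column_relations T N \<mu> =
     complex_span (tableau_space T N \<mu>)
       {basis_vector t \<oplus>\<^bsub>tableau_space T N \<mu>\<^esub> basis_vector (exchange x y t) | t a x y.
          t \<in> tableaux T N \<mu> \<and> a \<in> nodes T \<and> x \<in> set (t a) \<and> y \<in> set (t a) \<and> x \<noteq> y}"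

definition M_module :: "plane_tree \<Rightarrow> nat \<Rightarrow> (nat list \<Rightarrow> nat)
    \<Rightarrow> (nat \<Rightarrow> nat, (tableau \<Rightarrow> complex) set) rep" where
  "M_module T N \<mu> = quotient_rep (tableau_space T N \<mu>) (column_relations T N \<mu>)"

definition tableau_class :: "plane_tree \<Rightarrow> nat \<Rightarrow> (nat list \<Rightarrow> nat)
    \<Rightarrow> tableau \<Rightarrow> (tableau \<Rightarrow> complex) set" where
  "tableau_class T N \<mu> t =
     column_relations T N \<mu> +>\<^bsub>tableau_space T N \<mu>\<^esub> basis_vector t"


section \<open>The two kinds of Specht modules of a tree\<close>

text \<open>Within one tableau the exchanges below are pairwise different for different entries (columns are
  disjoint), so summing over entries is summing over the resulting tableaux. The top entry of a
  column is its head.\<close>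

definition first_relation :: "plane_tree \<Rightarrow> nat \<Rightarrow> (nat list \<Rightarrow> nat)
    \<Rightarrow> nat list \<Rightarrow> tableau \<Rightarrow> (tableau \<Rightarrow> complex) set" where
  "first_relation T N \<mu> a t =
     tableau_class T N \<mu> t \<ominus>\<^bsub>M_module T N \<mu>\<^esub>
       (\<Oplus>\<^bsub>M_module T N \<mu>\<^esub> x \<in> set (t a).
          tableau_class T N \<mu> (exchange x (hd (t (butlast a))) t))"

definition specht_first :: "plane_tree \<Rightarrow> nat \<Rightarrow> (nat list \<Rightarrow> nat)
    \<Rightarrow> (nat \<Rightarrow> nat, (tableau \<Rightarrow> complex) set set) rep" where
  "specht_first T N \<mu> =
     quotient_rep (M_module T N \<mu>)
       (complex_span (M_module T N \<mu>)
         {first_relation T N \<mu> a t | a t. a \<in> nodes T - {[]} \<and> t \<in> tableaux T N \<mu>})"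

definition second_relation :: "plane_tree \<Rightarrow> nat \<Rightarrow> (nat list \<Rightarrow> nat)
    \<Rightarrow> nat list \<Rightarrow> tableau \<Rightarrow> (tableau \<Rightarrow> complex) set" where
  "second_relation T N \<mu> a t =
     (of_nat (card (descendants T a) * \<mu> a) \<odot>\<^bsub>M_module T N \<mu>\<^esub> tableau_class T N \<mu> t)
       \<ominus>\<^bsub>M_module T N \<mu>\<^esub>
       (\<Oplus>\<^bsub>M_module T N \<mu>\<^esub> x \<in> set (t a).
          \<Oplus>\<^bsub>M_module T N \<mu>\<^esub> y \<in> (\<Union>b\<in>descendants T a. set (t b)).
            tableau_class T N \<mu> (exchange x y t))"

definition specht_second :: "plane_tree \<Rightarrow> nat \<Rightarrow> (nat list \<Rightarrow> nat)
    \<Rightarrow> (nat \<Rightarrow> nat, (tableau \<Rightarrow> complex) set set) rep" where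
  "specht_second T N \<mu> =
     quotient_rep (M_module T N \<mu>)
       (complex_span (M_module T N \<mu>)
         {second_relation T N \<mu> a t | a t. a \<in> internal_nodes T \<and> t \<in> tableaux T N \<mu>})"

end

theory Submission
  imports Defs "HOL-Library.Function_Algebras"
begin

text \<open>
  The two submodules of relations coincide, so the two Specht modules are equal for every tree. By
  duality it is enough that both are annihilated by the same functionals on \<open>M\<close>, that is, by the same
  functions \<open>f\<close> on tableaux that change sign under an exchange within a column. For nodes
  \<open>a \<noteq> b\<close> and an entry \<open>y\<close> of \<open>Col(a)\<close> put \<open>h\<^sub>b(t, y) = f(t) - \<Sum> f(s)\<close>, where \<open>s\<close> runs over the
  exchanges of \<open>y\<close> with an entry of \<open>Col(b)\<close>. Then \<open>f\<close> annihilates the first kind of relations iff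
  \<open>h\<^sub>b = 0\<close> for every \<open>b\<close> with parent \<open>a\<close>, and the second kind iff the sum of \<open>h\<^sub>b(t, y)\<close> over all
  descendants \<open>b\<close> of \<open>a\<close> and all \<open>y\<close> vanishes.

  The vanishing of \<open>h\<close> passes from the edges \<open>a - b\<close> and \<open>b - c\<close> to the pair \<open>a, c\<close> because of the
  braid relation \<open>(x z)(z y) = (z y)(x y)\<close>; this shows that the first kind of relations implies the second.
  Conversely \<open>h\<^sub>b\<close> is alternating in the entries of \<open>Col(b)\<close> together with \<open>y\<close>, whence
  \<open>\<Sum> |h\<^sub>b|\<^sup>2 = (1 + \<mu>(b)) \<Sum> h\<^sub>b f\<^sup>*\<close>. Thus the second kind of relations says that a sum of
  nonnegative terms is zero, and each \<open>h\<^sub>b\<close> vanishes separately.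
\<close>

section \<open>Complex representations\<close>

lemma representationD:
  assumes "representation G V"
  shows "group G" "module complex_ring V"
    "\<And>g x. g \<in> carrier G \<Longrightarrow> x \<in> carrier V \<Longrightarrow> act V g x \<in> carrier V"
    "\<And>g x y. g \<in> carrier G \<Longrightarrow> x \<in> carrier V \<Longrightarrow> y \<in> carrier V \<Longrightarrow>
       act V g (x \<oplus>\<^bsub>V\<^esub> y) = act V g x \<oplus>\<^bsub>V\<^esub> act V g y"
    "\<And>g c x. g \<in> carrier G \<Longrightarrow> x \<in> carrier V \<Longrightarrow> act V g (c \<odot>\<^bsub>V\<^esub> x) = c \<odot>\<^bsub>V\<^esub> act V g x"
    "\<And>x. x \<in> carrier V \<Longrightarrow> act V \<one>\<^bsub>G\<^esub> x = x"
    "\<And>g h x. g \<in> carrier G \<Longrightarrow> h \<in> carrier G \<Longrightarrow> x \<in> carrier V \<Longrightarrow>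
       act V (g \<otimes>\<^bsub>G\<^esub> h) x = act V g (act V h x)"
  using assms unfolding representation_def by blast+

lemma complex_ring_simps [simp]:
  "carrier complex_ring = UNIV"
  "x \<oplus>\<^bsub>complex_ring\<^esub> y = x + y"
  "x \<otimes>\<^bsub>complex_ring\<^esub> y = x * y"
  "\<one>\<^bsub>complex_ring\<^esub> = 1"
  "\<zero>\<^bsub>complex_ring\<^esub> = 0"
  by (simp_all add: ring_of_type_algebra_def)

lemma cring_complex_ring: "cring complex_ring"
  by (rule cring_from_type_algebra)

lemma complex_ring_a_inv [simp]: "\<ominus>\<^bsub>complex_ring\<^esub> x = - x"
proof -
  interpret R: cring complex_ring by (rule cring_complex_ring)
  show ?thesis using R.minus_equality[of "-x" x] by simp
qed

text \<open>Every element of \<open>Q\<close> is some \<open>p x\<close>, so each axiom for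
  \<open>Q\<close> is the image under \<open>p\<close> of the same axiom for \<open>V\<close>. This
  avoids verifying module axioms directly on cosets.\<close>

lemma representation_image:
  assumes V: "representation G V" and surj: "p ` carrier V = carrier Q"
    and p_zero: "p \<zero>\<^bsub>V\<^esub> = \<zero>\<^bsub>Q\<^esub>"
    and p_add: "\<And>x y. x \<in> carrier V \<Longrightarrow> y \<in> carrier V \<Longrightarrow> p (x \<oplus>\<^bsub>V\<^esub> y) = p x \<oplus>\<^bsub>Q\<^esub> p y"
    and p_smult: "\<And>c x. x \<in> carrier V \<Longrightarrow> p (c \<odot>\<^bsub>V\<^esub> x) = c \<odot>\<^bsub>Q\<^esub> p x"
    and p_act: "\<And>g x. g \<in> carrier G \<Longrightarrow> x \<in> carrier V \<Longrightarrow> p (act V g x) = act Q g (p x)"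
  shows "representation G Q"
proof -
  note VD = representationD[OF V]
  interpret V: module complex_ring V by (rule VD)
  interpret G: group G by (rule VD)
  have ex: "\<exists>x\<in>carrier V. u = p x" if "u \<in> carrier Q" for u
    using that surj by blast
  have mem [simp]: "p x \<in> carrier Q" if "x \<in> carrier V" for x
    using that surj by blast
  have sm [simp]: "c \<odot>\<^bsub>V\<^esub> x \<in> carrier V" if "x \<in> carrier V" for c x
    using V.smult_closed[of c x] that by simp
  have Q: "abelian_group Q"
  proof (rule abelian_groupI)
    fix u v assume "u \<in> carrier Q" "v \<in> carrier Q"
    then show "u \<oplus>\<^bsub>Q\<^esub> v \<in> carrier Q" "u \<oplus>\<^bsub>Q\<^esub> v = v \<oplus>\<^bsub>Q\<^esub> u"
      by (auto dest!: ex simp: p_add[symmetric] V.a_comm)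
  next
    show "\<zero>\<^bsub>Q\<^esub> \<in> carrier Q" by (metis p_zero mem V.zero_closed)
  next
    fix u v w assume "u \<in> carrier Q" "v \<in> carrier Q" "w \<in> carrier Q"
    then show "u \<oplus>\<^bsub>Q\<^esub> v \<oplus>\<^bsub>Q\<^esub> w = u \<oplus>\<^bsub>Q\<^esub> (v \<oplus>\<^bsub>Q\<^esub> w)"
      by (auto dest!: ex simp: p_add[symmetric] V.a_assoc)
  next
    fix u assume u: "u \<in> carrier Q"
    then show "\<zero>\<^bsub>Q\<^esub> \<oplus>\<^bsub>Q\<^esub> u = u"
      by (auto dest!: ex simp: p_add[symmetric] p_zero[symmetric])
    from u obtain x where "x \<in> carrier V" "u = p x" by (auto dest: ex)
    then show "\<exists>v\<in>carrier Q. v \<oplus>\<^bsub>Q\<^esub> u = \<zero>\<^bsub>Q\<^esub>"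
      by (intro bexI[of _ "p (\<ominus>\<^bsub>V\<^esub> x)"])
        (auto simp: p_add[symmetric] p_zero[symmetric] V.l_neg)
  qed
  have "module complex_ring Q"
  proof (rule moduleI[OF cring_complex_ring Q])
    fix a b u assume "u \<in> carrier Q"
    then obtain x where x: "x \<in> carrier V" "u = p x" by (auto dest: ex)
    show "a \<odot>\<^bsub>Q\<^esub> u \<in> carrier Q"
      using x by (simp add: p_smult[symmetric])
    show "(a \<oplus>\<^bsub>complex_ring\<^esub> b) \<odot>\<^bsub>Q\<^esub> u = a \<odot>\<^bsub>Q\<^esub> u \<oplus>\<^bsub>Q\<^esub> b \<odot>\<^bsub>Q\<^esub> u"
      using x V.smult_l_distr[of a b x] by (simp add: p_smult[symmetric] p_add[symmetric])
    show "(a \<otimes>\<^bsub>complex_ring\<^esub> b) \<odot>\<^bsub>Q\<^esub> u = a \<odot>\<^bsub>Q\<^esub> (b \<odot>\<^bsub>Q\<^esub> u)"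
      using x V.smult_assoc1[of a b x] by (simp add: p_smult[symmetric])
    show "\<one>\<^bsub>complex_ring\<^esub> \<odot>\<^bsub>Q\<^esub> u = u"
      using x V.smult_one[of x] by (simp add: p_smult[symmetric])
  next
    fix a u v assume "u \<in> carrier Q" "v \<in> carrier Q"
    then show "a \<odot>\<^bsub>Q\<^esub> (u \<oplus>\<^bsub>Q\<^esub> v) = a \<odot>\<^bsub>Q\<^esub> u \<oplus>\<^bsub>Q\<^esub> a \<odot>\<^bsub>Q\<^esub> v"
      by (auto dest!: ex simp: p_smult[symmetric] p_add[symmetric] V.smult_r_distr)
  qed
  then show ?thesis
    unfolding representation_def
    by (auto dest!: ex simp: p_smult[symmetric] p_add[symmetric] p_act[symmetric] VD G.is_group)
qed

text \<open>Closure under negation follows from closure under scalars, since -x is (-1) times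
  x.\<close>

lemma representation_submoduleI:
  assumes V: "representation G V" and sub: "H \<subseteq> carrier V" and zero: "\<zero>\<^bsub>V\<^esub> \<in> H"
    and add: "\<And>x y. x \<in> H \<Longrightarrow> y \<in> H \<Longrightarrow> x \<oplus>\<^bsub>V\<^esub> y \<in> H"
    and smult: "\<And>c x. x \<in> H \<Longrightarrow> c \<odot>\<^bsub>V\<^esub> x \<in> H"
  shows "submodule H complex_ring V"
proof -
  interpret V: module complex_ring V by (rule representationD[OF V])
  show ?thesis
  proof (rule V.submoduleI)
    fix x assume x: "x \<in> H"
    then have "\<ominus>\<^bsub>V\<^esub> x = (-1) \<odot>\<^bsub>V\<^esub> x"
      using V.smult_l_minus[of 1 x] V.smult_one[of x] sub by (auto simp: subset_iff)
    with smult[OF x, of "-1"] show "\<ominus>\<^bsub>V\<^esub> x \<in> H" by simp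
  qed (use assms in auto)
qed

lemma submodule_memD:
  assumes "representation G V" "submodule H complex_ring V"
  shows "H \<subseteq> carrier V" "\<zero>\<^bsub>V\<^esub> \<in> H"
    "\<And>x y. x \<in> H \<Longrightarrow> y \<in> H \<Longrightarrow> x \<oplus>\<^bsub>V\<^esub> y \<in> H"
    "\<And>c x. x \<in> H \<Longrightarrow> c \<odot>\<^bsub>V\<^esub> x \<in> H"
proof -
  interpret V: module complex_ring V by (rule representationD[OF assms(1)])
  show "H \<subseteq> carrier V" "\<And>x y. x \<in> H \<Longrightarrow> y \<in> H \<Longrightarrow> x \<oplus>\<^bsub>V\<^esub> y \<in> H"
    "\<And>c x. x \<in> H \<Longrightarrow> c \<odot>\<^bsub>V\<^esub> x \<in> H"
    using V.submoduleE[OF assms(2)] by auto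
  interpret submodule H complex_ring V by fact
  show "\<zero>\<^bsub>V\<^esub> \<in> H" using one_closed by simp
qed

lemma submodule_carrier:
  assumes "representation G V"
  shows "submodule (carrier V) complex_ring V"
proof -
  interpret V: module complex_ring V by (rule representationD[OF assms])
  show ?thesis by (rule representation_submoduleI[OF assms]) auto
qed

lemma complex_span_least:
  "submodule H complex_ring V \<Longrightarrow> A \<subseteq> H \<Longrightarrow> complex_span V A \<subseteq> H"
  unfolding complex_span_def by blast

lemma complex_span_superset: "A \<subseteq> complex_span V A"
  unfolding complex_span_def by blast

lemma submodule_complex_span:
  assumes V: "representation G V" and A: "A \<subseteq> carrier V"
  shows "submodule (complex_span V A) complex_ring V"
proof (rule representation_submoduleI[OF V])
  show "complex_span V A \<subseteq> carrier V"
    using submodule_carrier[OF V] A by (rule complex_span_least)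
qed (auto simp: complex_span_def dest: submodule_memD[OF V])

text \<open>For fixed \<open>g\<close>, the vectors that \<open>g\<close> sends into the span form a
  submodule containing \<open>A\<close>, hence containing the whole span.\<close>

lemma subrepresentation_complex_span:
  assumes V: "representation G V" and A: "A \<subseteq> carrier V"
    and stable: "\<And>g x. g \<in> carrier G \<Longrightarrow> x \<in> A \<Longrightarrow> act V g x \<in> A"
  shows "subrepresentation G (complex_span V A) V"
proof -
  note VD = representationD[OF V]
  interpret V: module complex_ring V by (rule VD)
  have sm: "submodule (complex_span V A) complex_ring V"
    by (rule submodule_complex_span[OF V A])
  note smD = submodule_memD[OF V sm]
  have "act V g x \<in> complex_span V A" if g: "g \<in> carrier G" and x: "x \<in> complex_span V A" for g x
  proof -
    let ?H = "{x \<in> carrier V. act V g x \<in> complex_span V A}"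
    \<comment> \<open>Zero is written as the scalar 0 times itself, so that compatibility of the
      action with scalars applies.\<close>
    have "act V g \<zero>\<^bsub>V\<^esub> = \<zero>\<^bsub>V\<^esub>"
      using VD(5)[OF g V.zero_closed, of 0] VD(3)[OF g V.zero_closed]
        V.smult_l_null[of "\<zero>\<^bsub>V\<^esub>"] V.smult_l_null[of "act V g \<zero>\<^bsub>V\<^esub>"] by simp
    then have "submodule ?H complex_ring V"
      by (intro representation_submoduleI[OF V]) (auto simp: VD(4,5)[OF g] smD V.smult_closed)
    moreover have "A \<subseteq> ?H"
      using A stable[OF g] subsetD[OF complex_span_superset[of A V]] by auto
    ultimately have "complex_span V A \<subseteq> ?H" by (rule complex_span_least)
    then show ?thesis using x by auto
  qed
  with sm show ?thesis unfolding subrepresentation_def by blast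
qed

lemma subrepresentation_carrier:
  "representation G V \<Longrightarrow> subrepresentation G (carrier V) V"
  unfolding subrepresentation_def by (auto intro: submodule_carrier representationD)

lemma rep_isomorphic_refl: "representation G V \<Longrightarrow> rep_isomorphic G V V"
  unfolding rep_isomorphic_def by (auto intro: exI[of _ id])

section \<open>Quotient representations\<close>

lemma quotient_rep_sel:
  "carrier (quotient_rep V W) = a_rcosets\<^bsub>V\<^esub> W"
  "\<zero>\<^bsub>quotient_rep V W\<^esub> = W"
  "add (quotient_rep V W) = set_add V"
  "c \<odot>\<^bsub>quotient_rep V W\<^esub> C = W <+>\<^bsub>V\<^esub> ((\<lambda>x. c \<odot>\<^bsub>V\<^esub> x) ` C)"
  "act (quotient_rep V W) g C = act V g ` C"
  by (simp_all add: quotient_rep_def)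

text \<open>The coset map respects all operations. These are exactly the hypotheses of
  \<open>representation_image\<close>, and later they allow computations in the quotient to be made
  on representatives.\<close>

lemma quotient_rep_hom:
  assumes V: "representation G V" and W: "subrepresentation G W V"
  shows "(\<lambda>x. W +>\<^bsub>V\<^esub> x) ` carrier V = carrier (quotient_rep V W)"
    and "W +>\<^bsub>V\<^esub> \<zero>\<^bsub>V\<^esub> = \<zero>\<^bsub>quotient_rep V W\<^esub>"
    and "\<And>x y. x \<in> carrier V \<Longrightarrow> y \<in> carrier V \<Longrightarrow>
      W +>\<^bsub>V\<^esub> (x \<oplus>\<^bsub>V\<^esub> y) = (W +>\<^bsub>V\<^esub> x) \<oplus>\<^bsub>quotient_rep V W\<^esub> (W +>\<^bsub>V\<^esub> y)"
    and "\<And>c x. x \<in> carrier V \<Longrightarrow>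
      W +>\<^bsub>V\<^esub> (c \<odot>\<^bsub>V\<^esub> x) = c \<odot>\<^bsub>quotient_rep V W\<^esub> (W +>\<^bsub>V\<^esub> x)"
    and "\<And>g x. g \<in> carrier G \<Longrightarrow> x \<in> carrier V \<Longrightarrow>
      W +>\<^bsub>V\<^esub> (act V g x) = act (quotient_rep V W) g (W +>\<^bsub>V\<^esub> x)"
proof -
  note VD = representationD[OF V]
  interpret V: module complex_ring V by (rule VD)
  have sm: "submodule W complex_ring V"
    and stable: "\<And>g x. g \<in> carrier G \<Longrightarrow> x \<in> W \<Longrightarrow> act V g x \<in> W"
    using W unfolding subrepresentation_def by auto
  note WD = submodule_memD[OF V sm]
  have "subgroup W (add_monoid V)" using sm by (rule submodule.axioms)
  then interpret W: abelian_subgroup W V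
    by (intro abelian_subgroupI3 additive_subgroupI V.abelian_group_axioms)
  show "(\<lambda>x. W +>\<^bsub>V\<^esub> x) ` carrier V = carrier (quotient_rep V W)"
    by (auto simp: quotient_rep_sel A_RCOSETS_def')
  show "W +>\<^bsub>V\<^esub> \<zero>\<^bsub>V\<^esub> = \<zero>\<^bsub>quotient_rep V W\<^esub>"
    by (simp add: quotient_rep_sel W.a_subset)
  show "W +>\<^bsub>V\<^esub> (x \<oplus>\<^bsub>V\<^esub> y) = (W +>\<^bsub>V\<^esub> x) \<oplus>\<^bsub>quotient_rep V W\<^esub> (W +>\<^bsub>V\<^esub> y)"
    if "x \<in> carrier V" "y \<in> carrier V" for x y
    using that by (simp add: quotient_rep_sel W.a_rcos_sum)
  show "W +>\<^bsub>V\<^esub> (c \<odot>\<^bsub>V\<^esub> x) = c \<odot>\<^bsub>quotient_rep V W\<^esub> (W +>\<^bsub>V\<^esub> x)" if x: "x \<in> carrier V" for c x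
  proof -
    have "W <+>\<^bsub>V\<^esub> (\<lambda>z. c \<odot>\<^bsub>V\<^esub> z) ` (W +>\<^bsub>V\<^esub> x)
      = (\<Union>w\<in>W. \<Union>w'\<in>W. {w \<oplus>\<^bsub>V\<^esub> c \<odot>\<^bsub>V\<^esub> (w' \<oplus>\<^bsub>V\<^esub> x)})"
      by (auto simp: set_add_def' a_r_coset_def')
    also have "\<dots> = (\<Union>w\<in>W. \<Union>w'\<in>W. {(w \<oplus>\<^bsub>V\<^esub> c \<odot>\<^bsub>V\<^esub> w') \<oplus>\<^bsub>V\<^esub> c \<odot>\<^bsub>V\<^esub> x})"
      using WD(1) x by (intro SUP_cong refl) (auto simp: V.smult_r_distr subset_iff V.a_assoc)
    also have "\<dots> = W +>\<^bsub>V\<^esub> (c \<odot>\<^bsub>V\<^esub> x)"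
    proof
      show "(\<Union>w\<in>W. \<Union>w'\<in>W. {(w \<oplus>\<^bsub>V\<^esub> c \<odot>\<^bsub>V\<^esub> w') \<oplus>\<^bsub>V\<^esub> c \<odot>\<^bsub>V\<^esub> x}) \<subseteq> W +>\<^bsub>V\<^esub> (c \<odot>\<^bsub>V\<^esub> x)"
        using WD(3,4) by (fastforce simp: a_r_coset_def')
      show "W +>\<^bsub>V\<^esub> (c \<odot>\<^bsub>V\<^esub> x) \<subseteq> (\<Union>w\<in>W. \<Union>w'\<in>W. {(w \<oplus>\<^bsub>V\<^esub> c \<odot>\<^bsub>V\<^esub> w') \<oplus>\<^bsub>V\<^esub> c \<odot>\<^bsub>V\<^esub> x})"
      proof
        fix z assume "z \<in> W +>\<^bsub>V\<^esub> (c \<odot>\<^bsub>V\<^esub> x)"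
        then obtain w where w: "w \<in> W" "z = w \<oplus>\<^bsub>V\<^esub> c \<odot>\<^bsub>V\<^esub> x" by (auto simp: a_r_coset_def')
        \<comment> \<open>Taking w' to be zero reaches every element of the coset, also when
          \<open>c\<close> is 0.\<close>
        then have "z = (w \<oplus>\<^bsub>V\<^esub> c \<odot>\<^bsub>V\<^esub> \<zero>\<^bsub>V\<^esub>) \<oplus>\<^bsub>V\<^esub> c \<odot>\<^bsub>V\<^esub> x"
          using WD(1) by (auto simp: subset_iff)
        with w(1) WD(2) show "z \<in> (\<Union>w\<in>W. \<Union>w'\<in>W. {(w \<oplus>\<^bsub>V\<^esub> c \<odot>\<^bsub>V\<^esub> w') \<oplus>\<^bsub>V\<^esub> c \<odot>\<^bsub>V\<^esub> x})"
          by blast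
      qed
    qed
    finally show ?thesis by (simp add: quotient_rep_sel)
  qed
  show "W +>\<^bsub>V\<^esub> (act V g x) = act (quotient_rep V W) g (W +>\<^bsub>V\<^esub> x)"
    if g: "g \<in> carrier G" and x: "x \<in> carrier V" for g x
  proof -
    interpret G: group G by (rule VD)
    \<comment> \<open>The image of a coset under \<open>g\<close> is again a full coset because
      \<open>g\<close> maps \<open>W\<close> onto itself; preimages are supplied by the inverse of
      \<open>g\<close>.\<close>
    have "act V g ` W = W"
    proof
      show "W \<subseteq> act V g ` W"
      proof
        fix w assume w: "w \<in> W"
        then have "w = act V g (act V (inv\<^bsub>G\<^esub> g) w)"
          using VD(7)[OF g G.inv_closed[OF g]] WD(1) VD(6) g by (auto simp: subset_iff)
        with stable[OF G.inv_closed[OF g] w] show "w \<in> act V g ` W" by blast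
      qed
    qed (use stable[OF g] in auto)
    then have "W +>\<^bsub>V\<^esub> (act V g x) = (\<Union>w\<in>W. {act V g w \<oplus>\<^bsub>V\<^esub> act V g x})"
      by (force simp: a_r_coset_def')
    also have "\<dots> = act V g ` (W +>\<^bsub>V\<^esub> x)"
      using WD(1) x VD(4)[OF g] by (auto simp: a_r_coset_def' subset_iff image_UN)
    finally show ?thesis by (simp add: quotient_rep_sel)
  qed
qed

lemma representation_quotient_rep:
  assumes "representation G V" "subrepresentation G W V"
  shows "representation G (quotient_rep V W)"
  by (rule representation_image[OF assms(1)]) (fact quotient_rep_hom[OF assms])+

text \<open>The vectors whose coset lies in the span of the images form a submodule
  \<open>?H\<close>. It contains \<open>A\<close>, and also \<open>B\<close>, whose elements become
  zero in the quotient. Spans in the quotient can thus be compared upstairs, modulo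
  \<open>B\<close>.\<close>

lemma complex_span_quotient_rep:
  assumes V: "representation G V" and W: "subrepresentation G W V" and A: "A \<subseteq> carrier V"
    and B: "B \<subseteq> carrier V" "W = complex_span V B"
    and x: "x \<in> complex_span V (B \<union> A)"
  shows "W +>\<^bsub>V\<^esub> x \<in> complex_span (quotient_rep V W) ((\<lambda>x. W +>\<^bsub>V\<^esub> x) ` A)"
proof -
  let ?Q = "quotient_rep V W" and ?p = "\<lambda>x. W +>\<^bsub>V\<^esub> x"
  let ?S = "complex_span ?Q (?p ` A)"
  let ?H = "{x \<in> carrier V. ?p x \<in> ?S}"
  interpret V: module complex_ring V by (rule representationD[OF V])
  have Q: "representation G ?Q" by (rule representation_quotient_rep[OF V W])
  note hom = quotient_rep_hom[OF V W]
  have sm: "submodule ?S complex_ring ?Q"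
    using hom(1) A by (intro submodule_complex_span[OF Q]) blast
  note SD = submodule_memD[OF Q sm]
  have H: "submodule ?H complex_ring V"
    by (rule representation_submoduleI[OF V]) (auto simp: hom(2-4) SD V.smult_closed)
  have "?p b \<in> ?S" if b: "b \<in> B" for b
  proof -
    have smW: "submodule W complex_ring V" using W unfolding subrepresentation_def by auto
    have "b \<in> W" unfolding B(2) using b by (rule subsetD[OF complex_span_superset])
    then have "?p b = W"
      using submodule_memD(1)[OF V smW] by (intro V.a_coset_join2 submodule.axioms(1)[OF smW]) auto
    with SD(2) show ?thesis by (simp add: quotient_rep_sel)
  qed
  then have "B \<union> A \<subseteq> ?H" using A B(1) complex_span_superset[of "?p ` A" ?Q] by auto
  with complex_span_least[OF H] x show ?thesis by blast
qed

section \<open>Linear functionals on finitely supported functions\<close>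

text \<open>A basis of \<open>U\<close> stays independent when \<open>v\<close> is added, so some
  linear \<open>g\<close> is 0 on \<open>U\<close> and 1 at \<open>v\<close>. Finite support turns
  \<open>g\<close> into the coefficient function \<open>f\<close>.\<close>

lemma separating_functional:
  fixes U :: "('a \<Rightarrow> 'b::field) set" and v :: "'a \<Rightarrow> 'b"
  assumes S: "finite S"
    and zero: "(\<lambda>t. 0) \<in> U"
    and add: "\<And>u w. u \<in> U \<Longrightarrow> w \<in> U \<Longrightarrow> (\<lambda>t. u t + w t) \<in> U"
    and scale: "\<And>c u. u \<in> U \<Longrightarrow> (\<lambda>t. c * u t) \<in> U"
    and supp: "\<And>u t. u \<in> U \<Longrightarrow> t \<notin> S \<Longrightarrow> u t = 0" "\<And>t. t \<notin> S \<Longrightarrow> v t = 0"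
    and v: "v \<notin> U"
  obtains f where "\<And>u. u \<in> U \<Longrightarrow> (\<Sum>t\<in>S. f t * u t) = 0" "(\<Sum>t\<in>S. f t * v t) \<noteq> 0"
proof -
  let ?sc = "\<lambda>(c::'b) (w::'a \<Rightarrow> 'b) t. c * w t"
  interpret vector_space_pair ?sc "(*) :: 'b \<Rightarrow> 'b \<Rightarrow> 'b"
    by unfold_locales (auto simp: fun_eq_iff algebra_simps)
  have sub: "vs1.subspace U"
    unfolding vs1.subspace_def using zero add scale
    by (auto simp: plus_fun_def zero_fun_def)
  obtain B where B: "B \<subseteq> U" "vs1.independent B" "U \<subseteq> vs1.span B"
    by (rule vs1.maximal_independent_subset)
  then have "vs1.span B = U" using vs1.span_minimal[OF B(1) sub] by auto
  with v B have "vs1.independent (insert v B)" by (simp add: vs1.independent_insert)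
  then obtain g where g: "Vector_Spaces.linear ?sc (*) g"
      and gB: "\<And>b. b \<in> insert v B \<Longrightarrow> g b = (if b = v then 1 else 0)"
    using linear_independent_extend[of "insert v B" "\<lambda>b. if b = v then 1 else 0"] by blast
  interpret g: Vector_Spaces.linear ?sc "(*)" g by (rule g)
  have "g b = 0" if "b \<in> B" for b using gB[of b] B(1) v that by auto
  then have g0: "g u = 0" if "u \<in> U" for u
    using linear_eq_0_on_span[OF g, of B u] B(3) that by blast
  let ?e = "\<lambda>t s. if s = t then 1 else 0"
  \<comment> \<open>A function supported on \<open>S\<close> is the finite combination of the unit
    functions \<open>?e t\<close>, so \<open>g\<close> is determined by its values on them.\<close>
  have eval: "(\<Sum>t\<in>S. g (?e t) * w t) = g w" if "\<And>t. t \<notin> S \<Longrightarrow> w t = 0" for w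
  proof -
    have "(\<Sum>t\<in>S. ?sc (w t) (?e t)) s = w s" for s
    proof -
      have "(\<Sum>t\<in>S. ?sc (w t) (?e t)) s = (\<Sum>t\<in>S. w t * ?e t s)"
        using S by (induction S) auto
      also have "\<dots> = w s" using S that by (auto simp: if_distrib sum.delta cong: if_cong)
      finally show ?thesis .
    qed
    then have "w = (\<Sum>t\<in>S. ?sc (w t) (?e t))" by (intro ext) (rule sym)
    then have "g w = g (\<Sum>t\<in>S. ?sc (w t) (?e t))" by (rule arg_cong)
    also have "\<dots> = (\<Sum>t\<in>S. g (?sc (w t) (?e t)))" by (rule g.sum)
    also have "\<dots> = (\<Sum>t\<in>S. g (?e t) * w t)"
      by (intro sum.cong refl) (simp only: g.scale mult.commute)
    finally show ?thesis ..
  qed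
  show thesis
  proof
    show "(\<Sum>t\<in>S. g (?e t) * u t) = 0" if "u \<in> U" for u
      using eval[of u] supp(1)[OF that] g0[OF that] by simp
    show "(\<Sum>t\<in>S. g (?e t) * v t) \<noteq> 0"
      using eval[of v] supp(2) gB[of v] by simp
  qed
qed

section \<open>Trees\<close>

lemma Nil_in_nodes: "[] \<in> nodes T"
  by (cases T) simp

lemma finite_nodes: "finite (nodes T)"
  by (induction T rule: nodes.induct) auto

lemma append_in_nodesD: "a @ b \<in> nodes T \<Longrightarrow> a \<in> nodes T"
proof (induction a arbitrary: T)
  case (Cons i a)
  then show ?case by (cases T) auto
qed (rule Nil_in_nodes)

lemma butlast_in_nodes: "a \<in> nodes T \<Longrightarrow> butlast a \<in> nodes T"
  by (cases a rule: rev_cases) (auto dest: append_in_nodesD)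

lemma descendants_subset: "descendants T a \<subseteq> nodes T - {a}"
  unfolding descendants_def by auto

lemma butlast_neq_self: "b \<noteq> [] \<Longrightarrow> butlast b \<noteq> b"
  by (cases b rule: rev_cases) auto

lemma butlast_internal:
  assumes "b \<in> nodes T - {[]}"
  shows "butlast b \<in> internal_nodes T" "b \<in> descendants T (butlast b)"
  using assms butlast_in_nodes[of b T] butlast_neq_self[of b]
  by (auto simp: internal_nodes_def children_def descendants_def strict_prefix_def prefixeq_butlast)

text \<open>Induction down the path from \<open>a\<close>: the parent of a proper descendant is
  \<open>a\<close> itself or another proper descendant. The last index of an address is its last
  edge, hence the reverse list induction.\<close>

lemma descendants_induct [consumes 1, case_names child step]:
  assumes b: "b \<in> descendants T a"
    and child: "\<And>b. b \<in> nodes T - {[]} \<Longrightarrow> butlast b = a \<Longrightarrow> P b"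
    and step: "\<And>b. b \<in> nodes T - {[]} \<Longrightarrow> butlast b \<in> descendants T a \<Longrightarrow> P (butlast b) \<Longrightarrow> P b"
  shows "P b"
  using b
proof (induction b rule: rev_induct)
  case Nil
  then show ?case by (simp add: descendants_def)
next
  case (snoc i b)
  then have n: "b @ [i] \<in> nodes T - {[]}" "b \<in> nodes T" and "prefix a b"
    by (auto simp: descendants_def strict_prefix_def dest: append_in_nodesD)
  show ?case
  proof (cases "a = b")
    case True
    with child[OF n(1)] show ?thesis by simp
  next
    case False
    with n(2) \<open>prefix a b\<close> have "b \<in> descendants T a"
      by (simp add: descendants_def strict_prefix_def)
    with step[OF n(1)] snoc.IH show ?thesis by simp
  qed
qed

section \<open>Permuting the entries of tableaux\<close>

lemma permute_entries_id [simp]: "permute_entries id t = t"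
  by (simp add: permute_entries_def)

lemma permute_entries_comp: "permute_entries p (permute_entries q t) = permute_entries (p \<circ> q) t"
  by (simp add: permute_entries_def fun_eq_iff)

lemma set_permute_entries [simp]: "set (permute_entries p t a) = p ` set (t a)"
  by (simp add: permute_entries_def)

lemma exchange_commute: "exchange x y = exchange y x"
  by (simp add: exchange_def transpose_commute)

lemma exchange_exchange [simp]: "exchange x y (exchange x y t) = t"
  by (simp add: exchange_def permute_entries_comp)

text \<open>Both sides apply to the entries the 3-cycle sending \<open>y\<close> to
  \<open>x\<close>, \<open>x\<close> to \<open>z\<close> and \<open>z\<close> to
  \<open>y\<close>.\<close>

lemma exchange_braid:
  "x \<noteq> y \<Longrightarrow> y \<noteq> z \<Longrightarrow> x \<noteq> z \<Longrightarrow>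
    exchange x z (exchange z y t) = exchange z y (exchange x y t)"
  unfolding exchange_def permute_entries_comp
  by (rule arg_cong[where f = "\<lambda>p. permute_entries p t"])
    (auto simp: fun_eq_iff transpose_def)

text \<open>Conjugating the transposition of \<open>x\<close> and \<open>y\<close> by
  \<open>p\<close> gives the transposition of \<open>p x\<close> and \<open>p y\<close>.\<close>

lemma permute_exchange:
  assumes "bij p"
  shows "permute_entries p (exchange x y t) = exchange (p x) (p y) (permute_entries p t)"
proof -
  have "p \<circ> transpose x y = transpose (p x) (p y) \<circ> p"
    using bij_is_inj[OF assms] by (auto simp: fun_eq_iff transpose_def inj_eq)
  then show ?thesis by (simp add: exchange_def permute_entries_comp)
qed

lemma set_exchange_notin:
  assumes "x \<notin> set (t a)" "y \<notin> set (t a)"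
  shows "set (exchange x y t a) = set (t a)"
  using assms by (auto simp: exchange_def transpose_def image_iff)

lemma set_exchange_replace:
  assumes "x \<in> set (t a)" "y \<notin> set (t a)"
  shows "set (exchange x y t a) = insert y (set (t a) - {x})"
  using assms by (auto simp: exchange_def transpose_def image_iff)

lemma permute_entries_in_tableaux:
  assumes t: "t \<in> tableaux T N \<mu>" and p: "p permutes {1..N}"
  shows "permute_entries p t \<in> tableaux T N \<mu>"
proof -
  have inj: "inj p" using p by (rule permutes_inj)
  then have inj_on: "inj_on p A" for A by (rule inj_on_subset) simp
  have "(\<Union>a\<in>nodes T. set (permute_entries p t a)) = p ` (\<Union>a\<in>nodes T. set (t a))"
    by auto
  also have "\<dots> = {1..N}" using t permutes_image[OF p] by (simp add: tableaux_def)
  finally show ?thesis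
    using t inj by (simp add: tableaux_def permute_entries_def distinct_map inj_on flip: image_Int)
qed

lemma tableaux_entry:
  assumes "t \<in> tableaux T N \<mu>" "x \<in> set (t a)"
  shows "x \<in> {1..N}" "a \<in> nodes T"
proof -
  show "a \<in> nodes T" using assms by (cases "a \<in> nodes T") (auto simp: tableaux_def)
  with assms show "x \<in> {1..N}" unfolding tableaux_def by blast
qed

lemma tableaux_disjoint:
  assumes "t \<in> tableaux T N \<mu>" "a \<noteq> b" "x \<in> set (t a)"
  shows "x \<notin> set (t b)"
proof
  assume "x \<in> set (t b)"
  with assms tableaux_entry(2)[OF assms(1)] show False unfolding tableaux_def by blast
qed

lemma exchange_in_tableaux:
  assumes "t \<in> tableaux T N \<mu>" "x \<in> set (t a)" "y \<in> set (t b)"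
  shows "exchange x y t \<in> tableaux T N \<mu>"
  unfolding exchange_def using tableaux_entry[OF assms(1)] assms
  by (intro permute_entries_in_tableaux permutes_swap_id) blast+

lemma finite_tableaux: "finite (tableaux T N \<mu>)"
proof (rule finite_subset)
  \<comment> \<open>One finite set of lists bounds the columns at all nodes at once: entries at most
    \<open>N\<close>, length at most the largest \<mu>.\<close>
  let ?L = "{xs. set xs \<subseteq> {1..N} \<and> length xs \<le> Max (insert 0 (\<mu> ` nodes T))}"
  show "tableaux T N \<mu> \<subseteq> {t. (\<forall>a\<in>nodes T. t a \<in> ?L) \<and> (\<forall>a. a \<notin> nodes T \<longrightarrow> t a = [])}"
  proof
    fix t assume t: "t \<in> tableaux T N \<mu>"
    have "t a \<in> ?L" if a: "a \<in> nodes T" for a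
    proof -
      have "\<mu> a \<le> Max (insert 0 (\<mu> ` nodes T))" using a by (intro Max_ge) (auto simp: finite_nodes)
      with t a tableaux_entry(1)[OF t] show ?thesis by (auto simp: tableaux_def)
    qed
    with t show "t \<in> {t. (\<forall>a\<in>nodes T. t a \<in> ?L) \<and> (\<forall>a. a \<notin> nodes T \<longrightarrow> t a = [])}"
      by (simp add: tableaux_def)
  qed
  show "finite {t. (\<forall>a\<in>nodes T. t a \<in> ?L) \<and> (\<forall>a. a \<notin> nodes T \<longrightarrow> t a = [])}"
    using finite_set_of_finite_funs[OF finite_nodes[of T] finite_lists_length_le[of "{1..N}"], of _ "[]"]
    by (rule rev_finite_subset) auto
qed

section \<open>Alternating functionals\<close>

text \<open>These are the functions that kill the column relations, i.e. the functionals on M. The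
  address \<open>a\<close> may range over all lists since columns outside the tree are
  empty.\<close>

definition alternating :: "plane_tree \<Rightarrow> nat \<Rightarrow> (nat list \<Rightarrow> nat) \<Rightarrow> (tableau \<Rightarrow> complex) \<Rightarrow> bool" where
  "alternating T N \<mu> f \<longleftrightarrow>
     (\<forall>t\<in>tableaux T N \<mu>. \<forall>a x y. x \<in> set (t a) \<and> y \<in> set (t a) \<and> x \<noteq> y \<longrightarrow>
        f (exchange x y t) = - f t)"

text \<open>This is the quantity \<open>h\<^sub>b(t, y)\<close>. The column containing
  \<open>y\<close> is determined by \<open>t\<close> and is therefore not an argument.\<close>

definition defect :: "(tableau \<Rightarrow> complex) \<Rightarrow> nat list \<Rightarrow> tableau \<Rightarrow> nat \<Rightarrow> complex" where
  "defect f b t y = f t - (\<Sum>x\<in>set (t b). f (exchange x y t))"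

lemma alternatingD:
  "alternating T N \<mu> f \<Longrightarrow> t \<in> tableaux T N \<mu> \<Longrightarrow> x \<in> set (t a) \<Longrightarrow> y \<in> set (t a) \<Longrightarrow> x \<noteq> y \<Longrightarrow>
    f (exchange x y t) = - f t"
  unfolding alternating_def by blast

text \<open>The braid relation turns each summand into an exchange of \<open>z\<close> and
  \<open>x\<close> after that of \<open>x\<close> and \<open>y\<close>, which is a switch within
  Col(a). This serves to pass from the top entry of a column to any other entry.\<close>

lemma defect_exchange_column:
  assumes f: "alternating T N \<mu> f" and t: "t \<in> tableaux T N \<mu>" and ab: "a \<noteq> b"
    and y: "y \<in> set (t a)" and z: "z \<in> set (t a)" and yz: "y \<noteq> z"
  shows "defect f b (exchange y z t) y = - defect f b t y"
proof -
  note dis = tableaux_disjoint[OF t]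
  have set_b: "set (exchange y z t b) = set (t b)"
    using dis[OF ab] y z by (intro set_exchange_notin) auto
  have "f (exchange x y (exchange y z t)) = - f (exchange x y t)" if x: "x \<in> set (t b)" for x
  proof -
    have xn: "x \<notin> set (t a)" using dis[of b a x] x ab by auto
    then have xyz: "x \<noteq> y" "x \<noteq> z" using y z by auto
    let ?s = "exchange y x t"
    have s: "?s \<in> tableaux T N \<mu>" using t y x by (rule exchange_in_tableaux)
    \<comment> \<open>In \<open>?s\<close> the entry \<open>x\<close> has replaced \<open>y\<close>
      in column \<open>a\<close>, so it shares this column with \<open>z\<close>.\<close>
    have "set (?s a) = insert x (set (t a) - {y})" using y xn by (rule set_exchange_replace)
    then have "f (exchange z x ?s) = - f ?s"
      using z yz xyz by (intro alternatingD[OF f s, of _ a]) auto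
    moreover have "exchange z x (exchange x y t) = exchange x y (exchange z y t)"
      using xyz yz by (intro exchange_braid) auto
    ultimately show ?thesis by (simp add: exchange_commute)
  qed
  with alternatingD[OF f t y z yz] show ?thesis
    by (simp add: defect_def set_b sum_negf)
qed

text \<open>This is the alternation of \<open>h\<^sub>b\<close> in Col(b) together with
  \<open>y\<close>. The leading term and the summand of the exchanged pair trade places, and every
  other summand changes sign by the braid relation.\<close>

lemma defect_exchange:
  assumes f: "alternating T N \<mu> f" and t: "t \<in> tableaux T N \<mu>" and ab: "a \<noteq> b"
    and y: "y \<in> set (t a)" and x: "x \<in> set (t b)"
  shows "defect f b (exchange x y t) x = - defect f b t y"
proof -
  have yn: "y \<notin> set (t b)" using tableaux_disjoint[OF t ab y] .
  let ?B = "set (t b) - {x}"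
  have set_b: "set (exchange x y t b) = insert y ?B" using x yn by (rule set_exchange_replace)
  have "f (exchange w x (exchange x y t)) = - f (exchange w y t)" if w: "w \<in> ?B" for w
  proof -
    let ?s = "exchange w y t"
    have s: "?s \<in> tableaux T N \<mu>" using exchange_in_tableaux[OF t _ y, of w b] w by auto
    have "set (?s b) = insert y (set (t b) - {w})"
      using w yn by (intro set_exchange_replace) auto
    then have "f (exchange x y ?s) = - f ?s"
      using w x yn by (intro alternatingD[OF f s, of _ b]) auto
    moreover have "exchange w x (exchange x y t) = exchange x y ?s"
      using w x yn by (intro exchange_braid) auto
    ultimately show ?thesis by simp
  qed
  \<comment> \<open>The new column \<open>b\<close> consists of \<open>y\<close> and
    \<open>?B\<close>. The summand for \<open>y\<close> undoes the exchange and is split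
    off.\<close>
  then have "defect f b (exchange x y t) x
      = f (exchange x y t) - (f (exchange y x (exchange x y t)) + (\<Sum>w\<in>?B. - f (exchange w y t)))"
    unfolding defect_def set_b using yn by simp
  also have "\<dots> = - defect f b t y"
    using x by (simp add: defect_def exchange_commute[of y x] sum_negf sum.remove[of _ x])
  finally show ?thesis .
qed

text \<open>Expanding the conjugated factor gives the term with \<open>f t\<close> and one term for
  each entry \<open>x\<close> of Col(b). By the involution \<open>?i\<close> and the alternation of
  the defect, each family of exchanged terms sums to \<mu>(b) copies of the first.\<close>

lemma defect_norm:
  assumes f: "alternating T N \<mu> f" and ab: "a \<noteq> b" and b: "b \<in> nodes T"
  defines "P \<equiv> SIGMA t:tableaux T N \<mu>. set (t a)"
  shows "(\<Sum>(t, y)\<in>P. defect f b t y * cnj (defect f b t y))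
    = (1 + of_nat (\<mu> b)) * (\<Sum>(t, y)\<in>P. defect f b t y * cnj (f t))"
proof -
  let ?d = "defect f b"
  let ?R = "SIGMA ty:P. set (fst ty b)"
  \<comment> \<open>The exchange puts \<open>y\<close> into column \<open>b\<close> and
    \<open>x\<close> into column \<open>a\<close>, so the two entries swap roles. Applied twice,
    this gives back the triple.\<close>
  let ?i = "\<lambda>((t, y), x). ((exchange x y t, x), y)"
  have fin: "finite P" unfolding P_def by (simp add: finite_tableaux)
  have R: "((t, y), x) \<in> ?R \<longleftrightarrow> t \<in> tableaux T N \<mu> \<and> y \<in> set (t a) \<and> x \<in> set (t b)" for t y x
    by (auto simp: P_def)
  have closed: "?i r \<in> ?R" if "r \<in> ?R" for r
  proof -
    obtain t y x where r: "r = ((t, y), x)" by (metis surj_pair)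
    with that R have t: "t \<in> tableaux T N \<mu>" "y \<in> set (t a)" "x \<in> set (t b)" by auto
    then have "y \<notin> set (t b)" "x \<notin> set (t a)" using tableaux_disjoint[OF t(1)] ab by metis+
    then have "y \<in> set (exchange x y t b)" "x \<in> set (exchange x y t a)"
      using set_exchange_replace[of x t b y] set_exchange_replace[of y t a x] t(2,3)
      by (auto simp: exchange_commute[of x y])
    with exchange_in_tableaux[OF t(1,3,2)] show ?thesis unfolding r prod.case R by simp
  qed
  have card: "card (set (t b)) = \<mu> b" if "t \<in> tableaux T N \<mu>" for t
    using that b by (auto simp: tableaux_def distinct_card)
  \<comment> \<open>Only the conjugated defect is written out.\<close>
  have "(\<Sum>(t, y)\<in>P. ?d t y * cnj (?d t y))
      = (\<Sum>(t, y)\<in>P. ?d t y * cnj (f t) - (\<Sum>x\<in>set (t b). ?d t y * cnj (f (exchange x y t))))"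
    by (intro sum.cong refl)
      (auto simp: defect_def[of f b] right_diff_distrib sum_distrib_left cnj_sum)
  also have "\<dots> = (\<Sum>(t, y)\<in>P. ?d t y * cnj (f t))
      - (\<Sum>((t, y), x)\<in>?R. ?d t y * cnj (f (exchange x y t)))"
    using fin by (simp add: sum_subtractf sum.Sigma case_prod_unfold)
  \<comment> \<open>Reindexing by \<open>?i\<close> moves the exchange from \<open>f\<close> to the
    defect, where it only costs a sign.\<close>
  also have "(\<Sum>((t, y), x)\<in>?R. ?d t y * cnj (f (exchange x y t)))
      = (\<Sum>((t, y), x)\<in>?R. ?d (exchange x y t) x * cnj (f t))"
    by (rule sum.reindex_bij_witness[where i = ?i and j = ?i])
      (use closed in \<open>auto simp: exchange_commute split: prod.splits\<close>)
  also have "\<dots> = (\<Sum>((t, y), x)\<in>?R. - (?d t y * cnj (f t)))"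
    by (intro sum.cong refl) (auto simp: P_def defect_exchange[OF f _ ab])
  also have "\<dots> = (\<Sum>(t, y)\<in>P. \<Sum>x\<in>set (t b). - (?d t y * cnj (f t)))"
    using fin by (simp add: sum.Sigma case_prod_unfold del: sum_constant)
  also have "\<dots> = - of_nat (\<mu> b) * (\<Sum>(t, y)\<in>P. ?d t y * cnj (f t))"
    unfolding P_def sum_distrib_left by (intro sum.cong refl) (auto simp: card)
  finally show ?thesis by (simp add: algebra_simps)
qed

text \<open>Pairing the vanishing sum with the conjugate of \<open>f\<close> gives, by
  \<open>defect_norm\<close>, a sum of squared norms with positive weights 1/(1 + \<mu>(c)). Hence
  every norm is zero.\<close>

lemma defect_eq_0_of_sum:
  assumes f: "alternating T N \<mu> f" and B: "B \<subseteq> nodes T - {a}"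
    and sum0: "\<And>t. t \<in> tableaux T N \<mu> \<Longrightarrow> (\<Sum>b\<in>B. \<Sum>y\<in>set (t a). defect f b t y) = 0"
    and b: "b \<in> B" and t: "t \<in> tableaux T N \<mu>" and y: "y \<in> set (t a)"
  shows "defect f b t y = 0"
proof -
  define P where "P = (SIGMA t:tableaux T N \<mu>. set (t a))"
  have fin: "finite P" "finite B"
    using finite_subset[OF B] by (auto simp: P_def finite_tableaux finite_nodes)
  define n where "n c = (\<Sum>(t, y)\<in>P. (cmod (defect f c t y))\<^sup>2)" for c
  have n: "complex_of_real (n c / (1 + real (\<mu> c))) = (\<Sum>(t, y)\<in>P. defect f c t y * cnj (f t))"
    if "c \<in> B" for c
  proof -
    have "complex_of_real (n c) = (\<Sum>(t, y)\<in>P. defect f c t y * cnj (defect f c t y))"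
      by (simp only: n_def of_real_sum case_prod_unfold complex_norm_square)
    also have "\<dots> = (1 + of_nat (\<mu> c)) * (\<Sum>(t, y)\<in>P. defect f c t y * cnj (f t))"
      unfolding P_def using that B by (intro defect_norm[OF f]) auto
    finally show ?thesis
      using of_nat_neq_0[of "\<mu> c", where 'a = complex] by (simp add: field_simps)
  qed
  have "complex_of_real (\<Sum>c\<in>B. n c / (1 + real (\<mu> c)))
      = (\<Sum>c\<in>B. \<Sum>(t, y)\<in>P. defect f c t y * cnj (f t))"
    by (simp only: of_real_sum n cong: sum.cong)
  also have "\<dots> = (\<Sum>c\<in>B. \<Sum>t\<in>tableaux T N \<mu>. \<Sum>y\<in>set (t a). defect f c t y * cnj (f t))"
    by (simp add: P_def sum.Sigma finite_tableaux)
  \<comment> \<open>The factor \<open>cnj (f t)\<close> depends on neither \<open>c\<close> nor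
    \<open>y\<close>, so the assumed double sum can be isolated.\<close>
  also have "\<dots> = (\<Sum>t\<in>tableaux T N \<mu>. (\<Sum>c\<in>B. \<Sum>y\<in>set (t a). defect f c t y) * cnj (f t))"
    by (subst sum.swap) (simp add: sum_distrib_right)
  also have "\<dots> = 0" using sum0 by simp
  finally have "(\<Sum>c\<in>B. n c / (1 + real (\<mu> c))) = 0" by (simp only: of_real_eq_0_iff)
  moreover have nn: "n c \<ge> 0" for c unfolding n_def by (intro sum_nonneg) auto
  ultimately have "n b / (1 + real (\<mu> b)) = 0"
    using b fin by (subst (asm) sum_nonneg_eq_0_iff) (auto intro!: divide_nonneg_pos)
  then have "n b = 0" by (simp add: add_nonneg_eq_0_iff)
  moreover have "(t, y) \<in> P" using t y by (simp add: P_def)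
  ultimately have "(case (t, y) of (t, y) \<Rightarrow> (cmod (defect f b t y))\<^sup>2) = 0"
    unfolding n_def using fin by (subst (asm) sum_nonneg_eq_0_iff) auto
  then show ?thesis by simp
qed

text \<open>Each exchange of \<open>y\<close> with an entry \<open>z\<close> of Col(c) is expanded
  through Col(b) and reordered by the braid relation. After swapping the sums, the one over Col(c)
  collapses first, then the one over Col(b).\<close>

lemma defect_eq_0_trans:
  assumes abc: "a \<noteq> b" "b \<noteq> c" "a \<noteq> c"
    and ab: "\<And>t y. t \<in> tableaux T N \<mu> \<Longrightarrow> y \<in> set (t a) \<Longrightarrow> defect f b t y = 0"
    and bc: "\<And>t y. t \<in> tableaux T N \<mu> \<Longrightarrow> y \<in> set (t b) \<Longrightarrow> defect f c t y = 0"
    and t: "t \<in> tableaux T N \<mu>" and y: "y \<in> set (t a)"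
  shows "defect f c t y = 0"
proof -
  note dis = tableaux_disjoint[OF t]
  have "(\<Sum>z\<in>set (t c). f (exchange z y t))
      = (\<Sum>z\<in>set (t c). \<Sum>x\<in>set (t b). f (exchange z y (exchange x y t)))"
  proof (rule sum.cong[OF refl])
    fix z assume z: "z \<in> set (t c)"
    let ?u = "exchange z y t"
    have zn: "z \<notin> set (t a)" "z \<notin> set (t b)" and yn: "y \<notin> set (t b)"
      using dis[of c a z] dis[of c b z] dis[of a b y] z y abc by auto
    have u: "?u \<in> tableaux T N \<mu>" using t z y by (rule exchange_in_tableaux)
    \<comment> \<open>In \<open>?u\<close> the entry \<open>z\<close> lies in column
      \<open>a\<close>, so the relation for the pair \<open>a\<close>, \<open>b\<close> applies to
      it.\<close>
    have "set (?u a) = insert z (set (t a) - {y})"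
      using set_exchange_replace[of y t a z] y zn by (simp add: exchange_commute)
    then have "defect f b ?u z = 0" by (intro ab u) simp
    moreover have "set (?u b) = set (t b)" using zn yn by (intro set_exchange_notin)
    ultimately have "f ?u = (\<Sum>x\<in>set (t b). f (exchange x z ?u))" by (simp add: defect_def)
    also have "\<dots> = (\<Sum>x\<in>set (t b). f (exchange z y (exchange x y t)))"
      using zn yn y by (intro sum.cong refl arg_cong[of _ _ f] exchange_braid) auto
    finally show "f ?u = \<dots>" .
  qed
  also have "\<dots> = (\<Sum>x\<in>set (t b). \<Sum>z\<in>set (t c). f (exchange z y (exchange x y t)))"
    by (rule sum.swap)
  also have "\<dots> = (\<Sum>x\<in>set (t b). f (exchange x y t))"
  proof (rule sum.cong[OF refl])
    fix x assume x: "x \<in> set (t b)"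
    let ?u = "exchange x y t"
    have u: "?u \<in> tableaux T N \<mu>" using t x y by (rule exchange_in_tableaux)
    have "y \<notin> set (t b)" using dis[of a b y] y abc by auto
    \<comment> \<open>Now \<open>y\<close> lies in column \<open>b\<close>, so the relation for the
      pair \<open>b\<close>, \<open>c\<close> applies to it.\<close>
    then have "set (?u b) = insert y (set (t b) - {x})" by (intro set_exchange_replace x)
    then have "defect f c ?u y = 0" by (intro bc u) simp
    moreover have "set (?u c) = set (t c)"
      using dis[of a c y] dis[of b c x] x y abc by (intro set_exchange_notin) auto
    ultimately show "(\<Sum>z\<in>set (t c). f (exchange z y ?u)) = f ?u" by (simp add: defect_def)
  qed
  also have "\<dots> = f t" using ab[OF t y] by (simp add: defect_def)
  finally show ?thesis by (simp add: defect_def)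
qed

text \<open>Vanishing propagates down the path from \<open>a\<close> to \<open>b\<close>, one edge
  at a time, by \<open>defect_eq_0_trans\<close> with the parent of \<open>b\<close> in the
  middle.\<close>

lemma defect_eq_0_descendant:
  assumes edge: "\<And>b t y. b \<in> nodes T - {[]} \<Longrightarrow> t \<in> tableaux T N \<mu> \<Longrightarrow> y \<in> set (t (butlast b)) \<Longrightarrow>
      defect f b t y = 0"
    and b: "b \<in> descendants T a"
  shows "t \<in> tableaux T N \<mu> \<Longrightarrow> y \<in> set (t a) \<Longrightarrow> defect f b t y = 0"
  using b
proof (induction b arbitrary: t y rule: descendants_induct)
  case (child b)
  then show ?case using edge[of b t y] by simp
next
  case (step b)
  have "a \<noteq> butlast b" "butlast b \<noteq> b" "a \<noteq> b"
    using step.hyps descendants_subset[of T a] prefixeq_butlast[of b] butlast_neq_self[of b]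
    by (auto simp: descendants_def dest: prefix_order.antisym)
  then show ?case
    using defect_eq_0_trans[of a "butlast b" b T N \<mu> f t y] step.IH edge[OF step.hyps(1)] step.prems
    by blast
qed

section \<open>The tableau space and its quotients\<close>

lemma tableau_space_sel [simp]:
  "\<zero>\<^bsub>tableau_space T N \<mu>\<^esub> = (\<lambda>t. 0)"
  "f \<oplus>\<^bsub>tableau_space T N \<mu>\<^esub> g = (\<lambda>t. f t + g t)"
  "c \<odot>\<^bsub>tableau_space T N \<mu>\<^esub> f = (\<lambda>t. c * f t)"
  "act (tableau_space T N \<mu>) p f = (\<lambda>t. f (permute_entries (Hilbert_Choice.inv p) t))"
  by (simp_all add: tableau_space_def)

lemma carrier_tableau_space:
  "f \<in> carrier (tableau_space T N \<mu>) \<longleftrightarrow> (\<forall>t. t \<notin> tableaux T N \<mu> \<longrightarrow> f t = 0)"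
  by (simp add: tableau_space_def)

lemma permute_entries_in_tableaux_iff:
  assumes "p permutes {1..N}"
  shows "permute_entries p t \<in> tableaux T N \<mu> \<longleftrightarrow> t \<in> tableaux T N \<mu>"
proof
  assume "permute_entries p t \<in> tableaux T N \<mu>"
  from permute_entries_in_tableaux[OF this permutes_inv[OF assms]]
  show "t \<in> tableaux T N \<mu>"
    by (simp only: permute_entries_comp permutes_inv_o[OF assms] permute_entries_id)
qed (rule permute_entries_in_tableaux[OF _ assms])

lemma representation_tableau_space: "representation (sym_group N) (tableau_space T N \<mu>)"
proof -
  let ?V = "tableau_space T N \<mu>"
  have "abelian_group ?V"
  proof (rule abelian_groupI)
    fix f assume "f \<in> carrier ?V"
    then show "\<exists>g\<in>carrier ?V. g \<oplus>\<^bsub>?V\<^esub> f = \<zero>\<^bsub>?V\<^esub>"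
      by (intro bexI[of _ "\<lambda>t. - f t"]) (auto simp: carrier_tableau_space)
  qed (auto simp: carrier_tableau_space algebra_simps)
  then have "module complex_ring ?V"
    by (intro moduleI cring_complex_ring) (auto simp: carrier_tableau_space algebra_simps)
  \<comment> \<open>The inverse in the action reverses the order of composition, which makes this a
    left action.\<close>
  moreover have "act ?V (p \<circ> q) f = act ?V p (act ?V q f)"
    if "p permutes {1..N}" "q permutes {1..N}" for p q f
    using that by (simp add: permute_entries_comp o_inv_distrib permutes_bij)
  moreover have "act ?V p f \<in> carrier ?V" if "p permutes {1..N}" "f \<in> carrier ?V" for p f
    using that permute_entries_in_tableaux_iff[OF permutes_inv[OF that(1)]]
    by (simp add: carrier_tableau_space)
  ultimately show ?thesis
    unfolding representation_def
    by (simp add: sym_group_is_group sym_group_carrier sym_group_mult sym_group_one)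
qed

text \<open>The pairing is bilinear, without conjugation: \<open>f\<close> stands for the functional
  with value \<open>f t\<close> on the basis vector of \<open>t\<close>.\<close>

definition pairing :: "plane_tree \<Rightarrow> nat \<Rightarrow> (nat list \<Rightarrow> nat) \<Rightarrow> (tableau \<Rightarrow> complex) \<Rightarrow>
    (tableau \<Rightarrow> complex) \<Rightarrow> complex" where
  "pairing T N \<mu> f u = (\<Sum>t\<in>tableaux T N \<mu>. f t * u t)"

lemma pairing_linear:
  "pairing T N \<mu> f (\<lambda>s. u s + w s) = pairing T N \<mu> f u + pairing T N \<mu> f w"
  "pairing T N \<mu> f (\<lambda>s. u s - w s) = pairing T N \<mu> f u - pairing T N \<mu> f w"
  "pairing T N \<mu> f (\<lambda>s. c * u s) = c * pairing T N \<mu> f u"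
  "pairing T N \<mu> f (\<lambda>s. \<Sum>i\<in>I. v i s) = (\<Sum>i\<in>I. pairing T N \<mu> f (v i))"
  unfolding pairing_def
  by (simp_all add: sum.distrib sum_subtractf sum_distrib_left algebra_simps sum.swap[of _ I])

lemma pairing_basis_vector:
  "t \<in> tableaux T N \<mu> \<Longrightarrow> pairing T N \<mu> f (basis_vector t) = f t"
  by (simp add: pairing_def basis_vector_def if_distrib finite_tableaux cong: if_cong)

text \<open>Double annihilator principle in finite dimension: a vector outside the span would be
  separated from it by some functional.\<close>

lemma in_complex_span_tableau_space:
  assumes A: "A \<subseteq> carrier (tableau_space T N \<mu>)" and v: "v \<in> carrier (tableau_space T N \<mu>)"
    and *: "\<And>f. (\<And>u. u \<in> A \<Longrightarrow> pairing T N \<mu> f u = 0) \<Longrightarrow> pairing T N \<mu> f v = 0"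
  shows "v \<in> complex_span (tableau_space T N \<mu>) A"
proof (rule ccontr)
  let ?V = "tableau_space T N \<mu>"
  let ?U = "complex_span ?V A"
  assume nv: "v \<notin> ?U"
  have "submodule ?U complex_ring ?V"
    by (rule submodule_complex_span[OF representation_tableau_space A])
  note U = submodule_memD[OF representation_tableau_space this, simplified]
  have supp: "u t = 0" if "u \<in> ?U" "t \<notin> tableaux T N \<mu>" for u t
    using U(1) that by (auto simp: carrier_tableau_space)
  have "v t = 0" if "t \<notin> tableaux T N \<mu>" for t
    using v that by (simp add: carrier_tableau_space)
  note v0 = this
  obtain f where f: "\<And>u. u \<in> ?U \<Longrightarrow> pairing T N \<mu> f u = 0" "pairing T N \<mu> f v \<noteq> 0"
    unfolding pairing_def
    by (rule separating_functional[of "tableaux T N \<mu>" ?U v]) (use U supp v0 nv finite_tableaux in blast)+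
  have "pairing T N \<mu> f u = 0" if "u \<in> A" for u
    using f(1) subsetD[OF complex_span_superset that] .
  with * f(2) show False by blast
qed

lemma basis_vector_in_carrier:
  "t \<in> tableaux T N \<mu> \<Longrightarrow> basis_vector t \<in> carrier (tableau_space T N \<mu>)"
  by (auto simp: carrier_tableau_space basis_vector_def)

lemma basis_vector_permute:
  assumes "p permutes {1..N}"
  shows "basis_vector t (permute_entries (Hilbert_Choice.inv p) s) = basis_vector (permute_entries p t) s"
proof -
  have "permute_entries (Hilbert_Choice.inv p) s = t \<longleftrightarrow> s = permute_entries p t"
    by (metis permute_entries_comp permutes_inv_o[OF assms] permute_entries_id)
  then show ?thesis by (simp add: basis_vector_def)
qed

section \<open>Column relations and the quotient M\<close>

definition column_generators :: "plane_tree \<Rightarrow> nat \<Rightarrow> (nat list \<Rightarrow> nat) \<Rightarrow> (tableau \<Rightarrow> complex) set" where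
  "column_generators T N \<mu> =
     {\<lambda>s. basis_vector t s + basis_vector (exchange x y t) s | t a x y.
        t \<in> tableaux T N \<mu> \<and> a \<in> nodes T \<and> x \<in> set (t a) \<and> y \<in> set (t a) \<and> x \<noteq> y}"

lemma column_relations_eq:
  "column_relations T N \<mu> = complex_span (tableau_space T N \<mu>) (column_generators T N \<mu>)"
  by (simp add: column_relations_def column_generators_def)

lemma column_generators_carrier:
  "column_generators T N \<mu> \<subseteq> carrier (tableau_space T N \<mu>)"
proof -
  have "(\<lambda>s. basis_vector t s + basis_vector (exchange x y t) s) \<in> carrier (tableau_space T N \<mu>)"
    if "t \<in> tableaux T N \<mu>" "x \<in> set (t a)" "y \<in> set (t a)" for t a x y
    using basis_vector_in_carrier[OF that(1)] basis_vector_in_carrier[OF exchange_in_tableaux[OF that]]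
    by (simp add: carrier_tableau_space)
  then show ?thesis by (auto simp: column_generators_def)
qed

text \<open>The pairing of \<open>f\<close> with a generator is
  \<open>f t + f (exchange x y t)\<close>, so annihilating the generators is the same as changing
  sign.\<close>

lemma alternating_iff_pairing:
  "alternating T N \<mu> f \<longleftrightarrow> (\<forall>u\<in>column_generators T N \<mu>. pairing T N \<mu> f u = 0)"
proof -
  have "pairing T N \<mu> f (\<lambda>s. basis_vector t s + basis_vector (exchange x y t) s) = 0 \<longleftrightarrow>
      f (exchange x y t) = - f t"
    if "t \<in> tableaux T N \<mu>" "x \<in> set (t a)" "y \<in> set (t a)" for t a x y
    using that exchange_in_tableaux[OF that]
    by (simp add: pairing_linear pairing_basis_vector add_eq_0_iff)
  then show ?thesis
    unfolding alternating_def column_generators_def using tableaux_entry(2) by (auto; blast)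
qed

text \<open>A permutation \<open>p\<close> sends the generator for \<open>t\<close>,
  \<open>x\<close>, \<open>y\<close> to the one for the permuted tableau, \<open>p x\<close> and
  \<open>p y\<close>.\<close>

lemma subrepresentation_column_relations:
  "subrepresentation (sym_group N) (column_relations T N \<mu>) (tableau_space T N \<mu>)"
  unfolding column_relations_eq
proof (rule subrepresentation_complex_span[OF representation_tableau_space column_generators_carrier])
  fix p u assume "p \<in> carrier (sym_group N)" and u: "u \<in> column_generators T N \<mu>"
  then have p: "p permutes {1..N}" by (simp add: sym_group_carrier)
  from u obtain t a x y where t: "t \<in> tableaux T N \<mu>" "a \<in> nodes T" "x \<in> set (t a)" "y \<in> set (t a)" "x \<noteq> y"
    and u: "u = (\<lambda>s. basis_vector t s + basis_vector (exchange x y t) s)"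
    unfolding column_generators_def by blast
  have "act (tableau_space T N \<mu>) p u =
      (\<lambda>s. basis_vector (permute_entries p t) s
         + basis_vector (exchange (p x) (p y) (permute_entries p t)) s)"
    by (simp add: u basis_vector_permute[OF p] permute_exchange[OF permutes_bij[OF p]])
  moreover have "permute_entries p t \<in> tableaux T N \<mu>" "p x \<noteq> p y"
    using permute_entries_in_tableaux[OF t(1) p] t(5) permutes_inj[OF p] by (auto dest: injD)
  ultimately show "act (tableau_space T N \<mu>) p u \<in> column_generators T N \<mu>"
    unfolding column_generators_def using t(2-4) by fastforce
qed

abbreviation coset :: "plane_tree \<Rightarrow> nat \<Rightarrow> (nat list \<Rightarrow> nat) \<Rightarrow> (tableau \<Rightarrow> complex) \<Rightarrow>
    (tableau \<Rightarrow> complex) set" where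
  "coset T N \<mu> u \<equiv> column_relations T N \<mu> +>\<^bsub>tableau_space T N \<mu>\<^esub> u"

lemmas coset_hom = quotient_rep_hom[OF representation_tableau_space subrepresentation_column_relations,
    folded M_module_def]

lemma representation_M_module: "representation (sym_group N) (M_module T N \<mu>)"
  unfolding M_module_def
  by (rule representation_quotient_rep[OF representation_tableau_space subrepresentation_column_relations])

lemma coset_sum:
  assumes "\<And>i. i \<in> I \<Longrightarrow> v i \<in> carrier (tableau_space T N \<mu>)"
  shows "(\<Oplus>\<^bsub>M_module T N \<mu>\<^esub> i\<in>I. coset T N \<mu> (v i)) = coset T N \<mu> (\<lambda>s. \<Sum>i\<in>I. v i s)"
proof -
  interpret M: module complex_ring "M_module T N \<mu>"
    by (rule representationD[OF representation_M_module])
  have zero: "coset T N \<mu> (\<lambda>s. 0) = \<zero>\<^bsub>M_module T N \<mu>\<^esub>"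
    using coset_hom(2)[of T N \<mu>] by simp
  have mem: "coset T N \<mu> u \<in> carrier (M_module T N \<mu>)"
    if "u \<in> carrier (tableau_space T N \<mu>)" for u
    using that coset_hom(1)[of T N \<mu>] by blast
  show ?thesis
    using assms
  \<comment> \<open>For an infinite index set both sums default to zero.\<close>
  proof (induction I rule: infinite_finite_induct)
    case (insert i I)
    have "(\<lambda>s. \<Sum>i\<in>I. v i s) \<in> carrier (tableau_space T N \<mu>)"
      using insert.prems by (simp add: carrier_tableau_space)
    then show ?case
      using insert coset_hom(3)[of "v i" T N \<mu> "\<lambda>s. \<Sum>i\<in>I. v i s"] mem
      by (simp add: Pi_def)
  qed (simp_all add: zero)
qed

lemma coset_diff:
  assumes u: "u \<in> carrier (tableau_space T N \<mu>)" and v: "v \<in> carrier (tableau_space T N \<mu>)"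
  shows "coset T N \<mu> u \<ominus>\<^bsub>M_module T N \<mu>\<^esub> coset T N \<mu> v = coset T N \<mu> (\<lambda>s. u s - v s)"
proof -
  interpret M: module complex_ring "M_module T N \<mu>"
    by (rule representationD[OF representation_M_module])
  have mem: "coset T N \<mu> w \<in> carrier (M_module T N \<mu>)"
    if "w \<in> carrier (tableau_space T N \<mu>)" for w
    using that coset_hom(1)[of T N \<mu>] by blast
  have "(\<lambda>s. u s - v s) \<in> carrier (tableau_space T N \<mu>)"
    using u v by (simp add: carrier_tableau_space)
  \<comment> \<open>Splitting u as (u - v) + v reduces the difference to additivity and cancellation
    in M.\<close>
  moreover from this have "coset T N \<mu> u =
      coset T N \<mu> (\<lambda>s. u s - v s) \<oplus>\<^bsub>M_module T N \<mu>\<^esub> coset T N \<mu> v"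
    using coset_hom(3)[of "\<lambda>s. u s - v s" T N \<mu> v] v by simp
  ultimately show ?thesis using mem v
    by (simp add: a_minus_def M.a_assoc M.r_neg)
qed

section \<open>The two families of relations\<close>

text \<open>This vector and \<open>second_vector\<close> represent the two kinds of relations in the
  tableau space; their cosets in M are the relations themselves.\<close>

definition first_vector :: "nat list \<Rightarrow> tableau \<Rightarrow> tableau \<Rightarrow> complex" where
  "first_vector b t =
     (\<lambda>s. basis_vector t s - (\<Sum>x\<in>set (t b). basis_vector (exchange x (hd (t (butlast b))) t) s))"

definition second_vector :: "plane_tree \<Rightarrow> (nat list \<Rightarrow> nat) \<Rightarrow> nat list \<Rightarrow> tableau \<Rightarrow>
    tableau \<Rightarrow> complex" where
  "second_vector T \<mu> a t =
     (\<lambda>s. of_nat (card (descendants T a) * \<mu> a) * basis_vector t s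
        - (\<Sum>x\<in>set (t a). \<Sum>y\<in>(\<Union>b\<in>descendants T a. set (t b)). basis_vector (exchange x y t) s))"

context
  fixes T :: plane_tree and N :: nat and \<mu> :: "nat list \<Rightarrow> nat"
  assumes partition: "tree_partition T N \<mu>"
begin

text \<open>Positivity of \<mu> ensures that every column has a top entry, so \<open>hd\<close> is
  meaningful.\<close>

lemma hd_in_column:
  assumes "t \<in> tableaux T N \<mu>" "a \<in> nodes T"
  shows "t a \<noteq> []" "hd (t a) \<in> set (t a)"
proof -
  have "0 < \<mu> a" using assms(2) partition by (simp add: tree_partition_def)
  with assms have "0 < length (t a)" by (simp add: tableaux_def)
  then show "t a \<noteq> []" by simp
  then show "hd (t a) \<in> set (t a)" by simp
qed

lemma parent_hd:
  "t \<in> tableaux T N \<mu> \<Longrightarrow> b \<in> nodes T \<Longrightarrow> hd (t (butlast b)) \<in> set (t (butlast b))"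
  by (intro hd_in_column butlast_in_nodes)

lemma first_vector_carrier:
  assumes "t \<in> tableaux T N \<mu>" "b \<in> nodes T"
  shows "first_vector b t \<in> carrier (tableau_space T N \<mu>)"
  using basis_vector_in_carrier[OF assms(1)]
    basis_vector_in_carrier[OF exchange_in_tableaux[OF assms(1) _ parent_hd[OF assms]]]
  unfolding carrier_tableau_space first_vector_def by (auto intro!: sum.neutral)

lemma pairing_first_vector:
  assumes "t \<in> tableaux T N \<mu>" "b \<in> nodes T"
  shows "pairing T N \<mu> f (first_vector b t) = defect f b t (hd (t (butlast b)))"
  using assms exchange_in_tableaux[OF assms(1) _ parent_hd[OF assms]]
  by (simp add: first_vector_def defect_def pairing_linear pairing_basis_vector)

lemma first_relation_eq_coset:
  assumes "t \<in> tableaux T N \<mu>" "b \<in> nodes T"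
  shows "first_relation T N \<mu> b t = coset T N \<mu> (first_vector b t)"
proof -
  have *: "basis_vector (exchange x (hd (t (butlast b))) t) \<in> carrier (tableau_space T N \<mu>)"
    if "x \<in> set (t b)" for x
    using exchange_in_tableaux[OF assms(1) that parent_hd[OF assms]] by (rule basis_vector_in_carrier)
  then have "(\<lambda>s. \<Sum>x\<in>set (t b). basis_vector (exchange x (hd (t (butlast b))) t) s)
      \<in> carrier (tableau_space T N \<mu>)"
    by (simp add: carrier_tableau_space)
  with * show ?thesis
    unfolding first_relation_def tableau_class_def first_vector_def
    by (simp add: coset_sum coset_diff basis_vector_in_carrier[OF assms(1)])
qed

lemma second_exchange:
  assumes "t \<in> tableaux T N \<mu>" "x \<in> set (t a)" "y \<in> (\<Union>b\<in>descendants T a. set (t b))"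
  shows "exchange x y t \<in> tableaux T N \<mu>"
  using assms by (auto intro: exchange_in_tableaux)

lemma second_vector_carrier:
  assumes "t \<in> tableaux T N \<mu>"
  shows "second_vector T \<mu> a t \<in> carrier (tableau_space T N \<mu>)"
  using basis_vector_in_carrier[OF assms]
    basis_vector_in_carrier[OF second_exchange[OF assms]]
  unfolding carrier_tableau_space second_vector_def by (auto intro!: sum.neutral)

text \<open>Disjointness of columns splits the union over the descendants into one block per node
  \<open>b\<close>, and each block combines with its share of the leading term into defects.\<close>

lemma pairing_second_vector:
  assumes t: "t \<in> tableaux T N \<mu>" and a: "a \<in> nodes T"
  shows "pairing T N \<mu> f (second_vector T \<mu> a t)
    = (\<Sum>b\<in>descendants T a. \<Sum>y\<in>set (t a). defect f b t y)"
proof -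
  let ?D = "descendants T a"
  have D: "finite ?D" "?D \<subseteq> nodes T"
    using descendants_subset[of T a] finite_subset[OF _ finite_nodes] by auto
  have card: "card (set (t a)) = \<mu> a" using t a by (auto simp: tableaux_def distinct_card)
  have disj: "\<forall>b\<in>?D. \<forall>c\<in>?D. b \<noteq> c \<longrightarrow> set (t b) \<inter> set (t c) = {}"
    using tableaux_disjoint[OF t] by blast
  have "pairing T N \<mu> f (second_vector T \<mu> a t) = of_nat (card ?D * \<mu> a) * f t
      - (\<Sum>x\<in>set (t a). \<Sum>y\<in>(\<Union>b\<in>?D. set (t b)). f (exchange x y t))"
    using second_exchange[OF t]
    by (simp add: second_vector_def pairing_linear pairing_basis_vector t)
  also have "(\<Sum>x\<in>set (t a). \<Sum>y\<in>(\<Union>b\<in>?D. set (t b)). f (exchange x y t))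
      = (\<Sum>x\<in>set (t a). \<Sum>b\<in>?D. \<Sum>y\<in>set (t b). f (exchange y x t))"
    by (subst sum.UNION_disjoint[OF D(1) _ disj]) (simp_all add: exchange_commute)
  also have "\<dots> = (\<Sum>b\<in>?D. \<Sum>x\<in>set (t a). \<Sum>y\<in>set (t b). f (exchange y x t))"
    by (rule sum.swap)
  \<comment> \<open>The coefficient provides one copy of \<open>f t\<close> for each pair of a
    descendant and an entry of Col(a).\<close>
  also have "of_nat (card ?D * \<mu> a) * f t = (\<Sum>b\<in>?D. \<Sum>y\<in>set (t a). f t)"
    using card by simp
  finally show ?thesis by (simp only: defect_def sum_subtractf)
qed

lemma second_relation_eq_coset:
  assumes t: "t \<in> tableaux T N \<mu>"
  shows "second_relation T N \<mu> a t = coset T N \<mu> (second_vector T \<mu> a t)"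
proof -
  let ?Y = "\<Union>b\<in>descendants T a. set (t b)" and ?V = "tableau_space T N \<mu>"
  have 1: "basis_vector (exchange x y t) \<in> carrier ?V" if "x \<in> set (t a)" "y \<in> ?Y" for x y
    using second_exchange[OF t that] by (rule basis_vector_in_carrier)
  then have 2: "(\<lambda>s. \<Sum>y\<in>?Y. basis_vector (exchange x y t) s) \<in> carrier ?V"
    if "x \<in> set (t a)" for x
    using that unfolding carrier_tableau_space by (auto intro!: sum.neutral)
  then have 3: "(\<lambda>s. \<Sum>x\<in>set (t a). \<Sum>y\<in>?Y. basis_vector (exchange x y t) s) \<in> carrier ?V"
    unfolding carrier_tableau_space by (auto intro!: sum.neutral)
  interpret M: module complex_ring "M_module T N \<mu>"
    by (rule representationD[OF representation_M_module])
  have "(\<Oplus>\<^bsub>M_module T N \<mu>\<^esub> x \<in> set (t a). \<Oplus>\<^bsub>M_module T N \<mu>\<^esub> y \<in> ?Y.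
        coset T N \<mu> (basis_vector (exchange x y t)))
      = (\<Oplus>\<^bsub>M_module T N \<mu>\<^esub> x \<in> set (t a). coset T N \<mu> (\<lambda>s. \<Sum>y\<in>?Y. basis_vector (exchange x y t) s))"
  proof (intro M.finsum_cong' refl)
    show "(\<lambda>x. coset T N \<mu> (\<lambda>s. \<Sum>y\<in>?Y. basis_vector (exchange x y t) s))
        \<in> set (t a) \<rightarrow> carrier (M_module T N \<mu>)"
      using 2 coset_hom(1)[of T N \<mu>] by blast
  qed (rule coset_sum[OF 1])
  also have "\<dots> = coset T N \<mu> (\<lambda>s. \<Sum>x\<in>set (t a). \<Sum>y\<in>?Y. basis_vector (exchange x y t) s)"
    using 2 by (rule coset_sum)
  finally have sum: "(\<Oplus>\<^bsub>M_module T N \<mu>\<^esub> x \<in> set (t a). \<Oplus>\<^bsub>M_module T N \<mu>\<^esub> y \<in> ?Y.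
        coset T N \<mu> (basis_vector (exchange x y t))) = \<dots>" .
  have b: "basis_vector t \<in> carrier ?V" using t by (rule basis_vector_in_carrier)
  then have cb: "(\<lambda>s. c * basis_vector t s) \<in> carrier ?V" for c
    by (simp add: carrier_tableau_space)
  have smult: "c \<odot>\<^bsub>M_module T N \<mu>\<^esub> coset T N \<mu> (basis_vector t)
      = coset T N \<mu> (\<lambda>s. c * basis_vector t s)" for c
    using coset_hom(4)[OF b, of c] by simp
  show ?thesis
    unfolding second_relation_def tableau_class_def second_vector_def sum smult
    by (rule coset_diff[OF cb 3])
qed

text \<open>Exchanging \<open>y\<close> with the top entry puts \<open>y\<close> on top, where the
  defect vanishes, and changes the defect at \<open>y\<close> only by a sign.\<close>

lemma defect_parent_eq_0:
  assumes f: "alternating T N \<mu> f"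
    and top: "\<And>t. t \<in> tableaux T N \<mu> \<Longrightarrow> defect f b t (hd (t (butlast b))) = 0"
    and b: "b \<in> nodes T - {[]}" and t: "t \<in> tableaux T N \<mu>" and y: "y \<in> set (t (butlast b))"
  shows "defect f b t y = 0"
proof (cases "y = hd (t (butlast b))")
  case True
  with top[OF t] show ?thesis by simp
next
  case False
  let ?z = "hd (t (butlast b))"
  let ?s = "exchange y ?z t"
  have z: "t (butlast b) \<noteq> []" "?z \<in> set (t (butlast b))"
    using hd_in_column[OF t] butlast_in_nodes b by auto
  have "hd (?s (butlast b)) = y"
    using z(1) by (simp add: exchange_def permute_entries_def hd_map)
  with top[OF exchange_in_tableaux[OF t y z(2)]] have "defect f b ?s y = 0" by simp
  moreover have "defect f b ?s y = - defect f b t y"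
    using b by (intro defect_exchange_column[OF f t _ y z(2) False]) (simp add: butlast_neq_self)
  ultimately show ?thesis by simp
qed

section \<open>Equality of the two spans of relations\<close>

definition first_vectors :: "(tableau \<Rightarrow> complex) set" where
  "first_vectors = {first_vector b t | b t. b \<in> nodes T - {[]} \<and> t \<in> tableaux T N \<mu>}"

definition second_vectors :: "(tableau \<Rightarrow> complex) set" where
  "second_vectors = {second_vector T \<mu> a t | a t. a \<in> internal_nodes T \<and> t \<in> tableaux T N \<mu>}"

lemma first_vectors_carrier: "first_vectors \<subseteq> carrier (tableau_space T N \<mu>)"
  by (auto simp: first_vectors_def first_vector_carrier)

lemma second_vectors_carrier: "second_vectors \<subseteq> carrier (tableau_space T N \<mu>)"
  by (auto simp: second_vectors_def second_vector_carrier)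

text \<open>By duality it is enough to treat an alternating \<open>f\<close> that kills the second
  kind. The relation at the parent of \<open>b\<close> makes a sum of defects vanish, and
  \<open>defect_eq_0_of_sum\<close> isolates the one for \<open>b\<close>.\<close>

lemma first_vectors_in_span:
  "first_vectors \<subseteq> complex_span (tableau_space T N \<mu>) (column_generators T N \<mu> \<union> second_vectors)"
proof
  fix v assume "v \<in> first_vectors"
  then obtain b t where v: "v = first_vector b t" and b: "b \<in> nodes T - {[]}"
    and t: "t \<in> tableaux T N \<mu>" unfolding first_vectors_def by blast
  show "v \<in> complex_span (tableau_space T N \<mu>) (column_generators T N \<mu> \<union> second_vectors)"
  proof (rule in_complex_span_tableau_space)
    fix f assume f: "\<And>u. u \<in> column_generators T N \<mu> \<union> second_vectors \<Longrightarrow> pairing T N \<mu> f u = 0"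
    then have alt: "alternating T N \<mu> f" by (simp add: alternating_iff_pairing)
    let ?a = "butlast b"
    have a: "?a \<in> internal_nodes T" "?a \<in> nodes T" "b \<in> descendants T ?a"
      using butlast_internal[OF b] by (auto simp: internal_nodes_def)
    have "(\<Sum>b\<in>descendants T ?a. \<Sum>y\<in>set (s ?a). defect f b s y) = 0" if "s \<in> tableaux T N \<mu>" for s
      using f[of "second_vector T \<mu> ?a s"] that a(1)
      by (auto simp: second_vectors_def pairing_second_vector[OF that a(2)])
    then have "defect f b t (hd (t ?a)) = 0"
      using b parent_hd[OF t] by (intro defect_eq_0_of_sum[OF alt descendants_subset _ a(3) t]) auto
    then show "pairing T N \<mu> f v = 0" unfolding v using b t by (simp add: pairing_first_vector)
  next
    show "v \<in> carrier (tableau_space T N \<mu>)"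
      unfolding v using b t by (simp add: first_vector_carrier)
  qed (use column_generators_carrier second_vectors_carrier in blast)
qed

text \<open>Dually, an alternating \<open>f\<close> that kills the first kind has zero defect along
  every edge, first at the top entry and then at every entry. Hence it vanishes for every
  descendant, and the sum is zero term by term.\<close>

lemma second_vectors_in_span:
  "second_vectors \<subseteq> complex_span (tableau_space T N \<mu>) (column_generators T N \<mu> \<union> first_vectors)"
proof
  fix v assume "v \<in> second_vectors"
  then obtain a t where v: "v = second_vector T \<mu> a t" and a: "a \<in> nodes T"
    and t: "t \<in> tableaux T N \<mu>" unfolding second_vectors_def internal_nodes_def by blast
  show "v \<in> complex_span (tableau_space T N \<mu>) (column_generators T N \<mu> \<union> first_vectors)"
  proof (rule in_complex_span_tableau_space)
    fix f assume f: "\<And>u. u \<in> column_generators T N \<mu> \<union> first_vectors \<Longrightarrow> pairing T N \<mu> f u = 0"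
    then have alt: "alternating T N \<mu> f" by (simp add: alternating_iff_pairing)
    have "defect f b s (hd (s (butlast b))) = 0" if "b \<in> nodes T - {[]}" "s \<in> tableaux T N \<mu>" for b s
      using f[of "first_vector b s"] that by (auto simp: first_vectors_def pairing_first_vector)
    then have "defect f b s y = 0"
      if "b \<in> nodes T - {[]}" "s \<in> tableaux T N \<mu>" "y \<in> set (s (butlast b))" for b s y
      using defect_parent_eq_0[OF alt _ that] that(1) by blast
    then have "defect f b t y = 0" if "b \<in> descendants T a" "y \<in> set (t a)" for b y
      using defect_eq_0_descendant[of T N \<mu> f b a t y] that t by blast
    then show "pairing T N \<mu> f v = 0" unfolding v by (simp add: pairing_second_vector[OF t a])
  next
    show "v \<in> carrier (tableau_space T N \<mu>)"
      unfolding v using t by (rule second_vector_carrier)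
  qed (use column_generators_carrier first_vectors_carrier in blast)
qed

lemma first_relations_eq:
  "{first_relation T N \<mu> a t | a t. a \<in> nodes T - {[]} \<and> t \<in> tableaux T N \<mu>}
    = coset T N \<mu> ` first_vectors"
  by (force simp: first_vectors_def first_relation_eq_coset)

lemma second_relations_eq:
  "{second_relation T N \<mu> a t | a t. a \<in> internal_nodes T \<and> t \<in> tableaux T N \<mu>}
    = coset T N \<mu> ` second_vectors"
  by (force simp: second_vectors_def second_relation_eq_coset)

text \<open>Inclusions between spans in M are deduced from spans in the tableau space, once the
  column generators are added.\<close>

lemma complex_span_coset_le:
  assumes A: "A \<subseteq> carrier (tableau_space T N \<mu>)" and B: "B \<subseteq> carrier (tableau_space T N \<mu>)"
    and AB: "B \<subseteq> complex_span (tableau_space T N \<mu>) (column_generators T N \<mu> \<union> A)"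
  shows "complex_span (M_module T N \<mu>) (coset T N \<mu> ` B)
    \<subseteq> complex_span (M_module T N \<mu>) (coset T N \<mu> ` A)"
proof (rule complex_span_least)
  show "submodule (complex_span (M_module T N \<mu>) (coset T N \<mu> ` A)) complex_ring (M_module T N \<mu>)"
    using A coset_hom(1)[of T N \<mu>] by (intro submodule_complex_span[OF representation_M_module]) blast
  show "coset T N \<mu> ` B \<subseteq> complex_span (M_module T N \<mu>) (coset T N \<mu> ` A)"
    using complex_span_quotient_rep[OF representation_tableau_space
        subrepresentation_column_relations A column_generators_carrier column_relations_eq] AB
    unfolding M_module_def by blast
qed

text \<open>Both are quotients of M by the same submodule, so they are equal and not merely
  isomorphic.\<close>

lemma specht_first_eq_specht_second: "specht_first T N \<mu> = specht_second T N \<mu>"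
  unfolding specht_first_def specht_second_def first_relations_eq second_relations_eq
  using complex_span_coset_le[OF second_vectors_carrier first_vectors_carrier first_vectors_in_span]
    complex_span_coset_le[OF first_vectors_carrier second_vectors_carrier second_vectors_in_span]
  by (rule arg_cong[OF subset_antisym])

section \<open>Action of the symmetric group on the relations\<close>

lemma act_first_vector:
  assumes p: "p permutes {1..N}" and t: "t \<in> tableaux T N \<mu>" and b: "b \<in> nodes T"
  shows "act (tableau_space T N \<mu>) p (first_vector b t) = first_vector b (permute_entries p t)"
proof -
  note inj = permutes_inj[OF p]
  \<comment> \<open>Permuting entries keeps positions, so the top entry of a column goes to the top
    entry of the permuted column.\<close>
  have hd: "p (hd (t (butlast b))) = hd (permute_entries p t (butlast b))"
    using hd_in_column[OF t butlast_in_nodes[OF b]] by (simp add: permute_entries_def hd_map)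
  have "(\<Sum>x\<in>set (t b). basis_vector (permute_entries p (exchange x (hd (t (butlast b))) t)) s)
    = (\<Sum>x\<in>set (permute_entries p t b).
         basis_vector (exchange x (hd (permute_entries p t (butlast b))) (permute_entries p t)) s)" for s
    using inj by (simp add: sum.reindex inj_on_subset permute_exchange[OF permutes_bij[OF p]] hd)
  then show ?thesis
    by (simp add: first_vector_def basis_vector_permute[OF p])
qed

lemma representation_specht_first: "representation (sym_group N) (specht_first T N \<mu>)"
  unfolding specht_first_def first_relations_eq
proof (intro representation_quotient_rep subrepresentation_complex_span representation_M_module)
  show "coset T N \<mu> ` first_vectors \<subseteq> carrier (M_module T N \<mu>)"
    using first_vectors_carrier coset_hom(1)[of T N \<mu>] by blast
  fix p c assume pc: "p \<in> carrier (sym_group N)" and "c \<in> coset T N \<mu> ` first_vectors"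
  then obtain b t where c: "c = coset T N \<mu> (first_vector b t)"
    and b: "b \<in> nodes T - {[]}" and t: "t \<in> tableaux T N \<mu>"
    unfolding first_vectors_def by blast
  have p: "p permutes {1..N}" using pc by (simp add: sym_group_carrier)
  have "act (M_module T N \<mu>) p c = coset T N \<mu> (first_vector b (permute_entries p t))"
    using coset_hom(5)[OF pc first_vector_carrier[OF t]] act_first_vector[OF p t] b
    by (simp add: c del: tableau_space_sel)
  with b permute_entries_in_tableaux[OF t p]
  show "act (M_module T N \<mu>) p c \<in> coset T N \<mu> ` first_vectors"
    unfolding first_vectors_def by blast
qed

end

theorem theorem6p9:
  fixes T :: plane_tree and N :: nat and \<mu> :: "nat list \<Rightarrow> nat"
  assumes "tree_partition T N \<mu>"
  shows "(\<exists>H. subrepresentation (sym_group N) H (specht_second T N \<mu>) \<and>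
              rep_isomorphic (sym_group N) (specht_first T N \<mu>)
                ((specht_second T N \<mu>)\<lparr>carrier := H\<rparr>)) \<and>
         (is_path T \<longrightarrow>
            rep_isomorphic (sym_group N) (specht_first T N \<mu>) (specht_second T N \<mu>))"
proof -
  \<comment> \<open>Stability is checked for the first kind of relations only; the equality of the
    modules transfers it to the second.\<close>
  have rep: "representation (sym_group N) (specht_second T N \<mu>)"
    using representation_specht_first[OF assms] specht_first_eq_specht_second[OF assms] by simp
  then have "subrepresentation (sym_group N) (carrier (specht_second T N \<mu>)) (specht_second T N \<mu>)"
    by (rule subrepresentation_carrier)
  moreover from rep have "rep_isomorphic (sym_group N) (specht_first T N \<mu>) (specht_second T N \<mu>)"
    unfolding specht_first_eq_specht_second[OF assms] by (rule rep_isomorphic_refl)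
  \<comment> \<open>The submodule is the whole module, for which the update of the carrier changes
    nothing.\<close>
  ultimately show ?thesis
    by (intro conjI exI[of _ "carrier (specht_second T N \<mu>)"]) auto
qed

end
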